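(* Let $m,n\ge1$, $r=\min\{m,n\}$ and $1\le k\le r$. In the real analytic local ring at any matrix $X_0\in\operatorname{Mat}_{m,n}(\mathbb R)$ one has $$\overline{(Q_k)}^{\,\mathbb R}=\overline{I_k^2}^{\,\mathbb R},\qquad \overline{J(Q_k)}^{\,\mathbb R}=\overline{I_{k-1}I_k}^{\,\mathbb R}.$$ If $\operatorname{rank}X_0=s<k$, then the optimal Łojasiewicz gradient exponent of $Q_k$ at $X_0$ is $$1-\frac{1}{2(k-s)}.$$ In particular, at the origin the exponent is $(2k-1)/(2k)$, whereas on the rank-$(k-1)$ stratum it is $1/2$.
   Context: $\operatorname{Mat}_{m,n}(\mathbb R)$ is the space of real $m\times n$ matrices. For $0\le j\le r$, $I_j$ is the ideal generated by the $j\times j$ minors of the generic matrix (of coordinate functions), with $I_0=(1)$, and $$Q_j(X):=\sum_{|A|=|B|=j}\det(X_{A,B})^2,\qquad Q_0=1,$$ where $A,B$ range over all $j$-element sets of rows and columns respectively. $J(Q_k)$ is the ideal generated by all first partial derivatives of $Q_k$ with respect to the matrix entries. For an ideal $I=(g_1,\ldots,g_s)$ in the ring of real analytic germs at $X_0$ and a real analytic arc $\gamma:(\mathbb R,0)\to(\operatorname{Mat}_{m,n}(\mathbb R),X_0)$, put $\nu_\gamma(I)=\min_j\operatorname{ord}_t(g_j\circ\gamma)$. The real integral closure $\overline I^{\,\mathbb R}$ is the set of germs $h$ at $X_0$ with $\operatorname{ord}_t(h\circ\gamma)\ge\nu_\gamma(I)$ for every such arc $\gamma$ (equivalently $|h|\le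 C\max_j|g_j|$ near $X_0$). The optimal Łojasiewicz gradient exponent of $Q_k$ at $X_0$ is the infimum of all $\theta\in[1/2,1)$ for which there is $C>0$ with $\|\nabla Q_k(X)\|\ge C|Q_k(X)-Q_k(X_0)|^\theta$ for all $X$ sufficiently close to $X_0$. *)

theory Defs
  imports
    "HOL-Complex_Analysis.Complex_Analysis"
    "HOL-Algebra.Ideal_Product"
    "HOL-Algebra.QuotRing"
    "Jordan_Normal_Form.Determinant"
begin

no_notation Matrix.vec_index (infixl "$" 100)
type_synonym ('m, 'n) rmat = "((real, 'n) Finite_Cartesian_Product.vec, 'm) Finite_Cartesian_Product.vec"

unbundle no fps_syntax

text \<open>Rows and columns are indexed by finite linearly ordered types; the submatrix with row set
  \<open>A\<close> and column set \<open>B\<close> lists both sets in increasing order.\<close>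

definition minor :: "('m::{finite,linorder}) set \<Rightarrow> ('n::{finite,linorder}) set \<Rightarrow> ('m, 'n) rmat \<Rightarrow> real" where
  "minor A B X = Determinant.det (Matrix.mat (card A) (card B)
     (\<lambda>(p, q). X $ (sorted_list_of_set A ! p) $ (sorted_list_of_set B ! q)))"

definition Q :: "nat \<Rightarrow> ('m::{finite,linorder}, 'n::{finite,linorder}) rmat \<Rightarrow> real" where
  "Q j X = (\<Sum>A | card A = j. \<Sum>B | card B = j. (minor A B X)\<^sup>2)"

text \<open>A function is real analytic at \<open>X0\<close> if on some ball around \<open>X0\<close> it is the sum of an
  (unconditionally, hence absolutely) convergent power series in the entries of \<open>X - X0\<close>;
  a multi-index assigns an exponent to every matrix position.\<close>

abbreviation monomial :: "('m::finite, 'n::finite) rmat \<Rightarrow> ('m \<Rightarrow> 'n \<Rightarrow> nat) \<Rightarrow> real" where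
  "monomial Y \<alpha> \<equiv> \<Prod>i\<in>UNIV. \<Prod>j\<in>UNIV. (Y $ i $ j) ^ \<alpha> i j"

definition real_analytic_at :: "(('m::finite, 'n::finite) rmat \<Rightarrow> real) \<Rightarrow> ('m, 'n) rmat \<Rightarrow> bool" where
  "real_analytic_at f X0 \<longleftrightarrow>
     (\<exists>(c :: ('m \<Rightarrow> 'n \<Rightarrow> nat) \<Rightarrow> real) \<rho>. \<rho> > 0 \<and>
       (\<forall>X\<in>ball X0 \<rho>.
          ((\<lambda>\<alpha>. c \<alpha> * monomial (X - X0) \<alpha>) has_sum f X) UNIV))"

text \<open>The local ring of real analytic germs at \<open>X0\<close>: functions on the whole matrix space that are
  analytic at \<open>X0\<close>, modulo those vanishing in a neighbourhood of \<open>X0\<close>. A germ is thus the set of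
  all its representatives, see \<open>mem_germ_iff\<close> below.\<close>

definition analytic_functions :: "('m::finite, 'n::finite) rmat \<Rightarrow> (('m, 'n) rmat \<Rightarrow> real) ring" where
  "analytic_functions X0 =
     \<lparr>carrier = {f. real_analytic_at f X0}, mult = (\<lambda>f g X. f X * g X), one = (\<lambda>X. 1),
      zero = (\<lambda>X. 0), add = (\<lambda>f g X. f X + g X)\<rparr>"

definition null_functions :: "('m::finite, 'n::finite) rmat \<Rightarrow> (('m, 'n) rmat \<Rightarrow> real) set" where
  "null_functions X0 = {f. real_analytic_at f X0 \<and> (\<forall>\<^sub>F X in nhds X0. f X = 0)}"

definition germ_ring :: "('m::finite, 'n::finite) rmat \<Rightarrow> (('m, 'n) rmat \<Rightarrow> real) set ring" where
  "germ_ring X0 = analytic_functions X0 Quot null_functions X0"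

definition germ :: "('m::finite, 'n::finite) rmat \<Rightarrow> (('m, 'n) rmat \<Rightarrow> real) \<Rightarrow> (('m, 'n) rmat \<Rightarrow> real) set" where
  "germ X0 f = null_functions X0 +>\<^bsub>analytic_functions X0\<^esub> f"

text \<open>For \<open>j = 0\<close> the only minor is the empty one, so that \<open>Q 0 = 1\<close> and the ideal is the unit ideal;
  see \<open>Q_0\<close> and \<open>minors_ideal_0\<close> below.\<close>

definition minors_ideal ::
    "('m::{finite,linorder}, 'n::{finite,linorder}) rmat \<Rightarrow> nat \<Rightarrow> (('m, 'n) rmat \<Rightarrow> real) set set" where
  "minors_ideal X0 j =
     Idl\<^bsub>germ_ring X0\<^esub> {germ X0 (minor A B) |A B. card A = j \<and> card B = j}"

definition partial_deriv :: "'m::finite \<Rightarrow> 'n::finite \<Rightarrow> (('m, 'n) rmat \<Rightarrow> real) \<Rightarrow> ('m, 'n) rmat \<Rightarrow> real" where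
  "partial_deriv i j f X = deriv (\<lambda>t. f (X + t *\<^sub>R axis i (axis j 1))) 0"

definition grad :: "(('m::finite, 'n::finite) rmat \<Rightarrow> real) \<Rightarrow> ('m, 'n) rmat \<Rightarrow> ('m, 'n) rmat" where
  "grad f X = (\<chi> i j. partial_deriv i j f X)"

definition jacobian_ideal :: "('m::finite, 'n::finite) rmat \<Rightarrow> (('m, 'n) rmat \<Rightarrow> real) \<Rightarrow> (('m, 'n) rmat \<Rightarrow> real) set set" where
  "jacobian_ideal X0 f = Idl\<^bsub>germ_ring X0\<^esub> {germ X0 (partial_deriv i j f) |i j. True}"

definition analytic_arc :: "('m::finite, 'n::finite) rmat \<Rightarrow> (real \<Rightarrow> ('m, 'n) rmat) \<Rightarrow> bool" where
  "analytic_arc X0 \<gamma> \<longleftrightarrow> \<gamma> 0 = X0 \<and> (\<forall>i j. \<exists>F. (\<lambda>t. \<gamma> t $ i $ j) has_fps_expansion F)"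

text \<open>Order at 0 of a one-variable analytic function, the order of the zero germ being \<open>\<infinity>\<close>.\<close>

definition vanishing_order :: "(real \<Rightarrow> real) \<Rightarrow> enat" where
  "vanishing_order f = (let F = (THE F. f has_fps_expansion F) in if F = 0 then \<infinity> else enat (subdegree F))"

text \<open>Minimal order along the arc \<open>\<gamma>\<close> of a set \<open>G\<close> of germs. The order depends only on the germ, so all
  representatives are admitted; by \<open>arc_order_genideal\<close> below the value for an ideal is the
  value for any generating set of it.\<close>

definition arc_order :: "(real \<Rightarrow> ('m::finite, 'n::finite) rmat) \<Rightarrow> (('m, 'n) rmat \<Rightarrow> real) set set \<Rightarrow> enat" where
  "arc_order \<gamma> G = (INF h\<in>G. INF f\<in>h. vanishing_order (f \<circ> \<gamma>))"

definition real_integral_closure ::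
    "('m::finite, 'n::finite) rmat \<Rightarrow> (('m, 'n) rmat \<Rightarrow> real) set set \<Rightarrow> (('m, 'n) rmat \<Rightarrow> real) set set" where
  "real_integral_closure X0 I =
     {h \<in> carrier (germ_ring X0).
        \<forall>\<gamma>. analytic_arc X0 \<gamma> \<longrightarrow> (\<forall>f\<in>h. vanishing_order (f \<circ> \<gamma>) \<ge> arc_order \<gamma> I)}"

definition lojasiewicz_exponents :: "(('m::finite, 'n::finite) rmat \<Rightarrow> real) \<Rightarrow> ('m, 'n) rmat \<Rightarrow> real set" where
  "lojasiewicz_exponents f X0 =
     {\<theta> \<in> {1/2..<1}. \<exists>C>0. \<forall>\<^sub>F X in nhds X0. norm (grad f X) \<ge> C * \<bar>f X - f X0\<bar> powr \<theta>}"

text \<open>The infimum is taken in the extended reals, so that it is \<open>\<infinity>\<close> when no exponent is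
  admissible (rather than an unspecified real).\<close>

definition optimal_lojasiewicz_exponent :: "(('m::finite, 'n::finite) rmat \<Rightarrow> real) \<Rightarrow> ('m, 'n) rmat \<Rightarrow> ereal" where
  "optimal_lojasiewicz_exponent f X0 = (INF \<theta>\<in>lojasiewicz_exponents f X0. ereal \<theta>)"


subsection \<open>Analytic functions and their germs\<close>

lemma real_fps_expansion_unique:
  fixes f :: "real \<Rightarrow> real"
  assumes "f has_fps_expansion F" "f has_fps_expansion G"
  shows "F = G"
proof (rule ccontr)
  assume "F \<noteq> G"
  define D where "D = F - G"
  define n where "n = subdegree D"
  define S where "S = fps_shift n D"
  have nz: "fps_nth S 0 \<noteq> 0"
    using \<open>F \<noteq> G\<close> using nth_subdegree_nonzero[of D] by (simp add: S_def n_def D_def)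
  have D: "(\<lambda>_. 0) has_fps_expansion D"
    using has_fps_expansion_diff[OF assms] by (simp add: D_def)
  have DS: "D = S * fps_X ^ n"
    using \<open>F \<noteq> G\<close> by (simp add: S_def n_def D_def subdegree_decompose)
  have rS: "fps_conv_radius S > 0"
    using D by (simp add: S_def has_fps_expansion_def)
  have S: "eval_fps S has_fps_expansion S"
    using rS by (rule eval_fps_has_fps_expansion)
  have "\<forall>\<^sub>F z in nhds 0. eval_fps D z = 0"
    using D by (simp add: has_fps_expansion_def)
  moreover have "\<forall>\<^sub>F z in nhds 0. eval_fps D z = eval_fps S z * z ^ n"
  proof -
    have "(\<lambda>z. eval_fps S z * z ^ n) has_fps_expansion S * fps_X ^ n"
      by (intro fps_expansion_intros S)
    then show ?thesis by (simp add: has_fps_expansion_def DS)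
  qed
  ultimately have "\<forall>\<^sub>F z in nhds 0. eval_fps S z * z ^ n = 0"
    by eventually_elim simp
  then have "\<forall>\<^sub>F z in at 0. eval_fps S z = 0"
    unfolding eventually_at_filter by eventually_elim auto
  then have "(eval_fps S \<longlongrightarrow> 0) (at 0)"
    by (rule tendsto_eventually)
  moreover have "(eval_fps S \<longlongrightarrow> eval_fps S 0) (at 0)"
    using has_fps_expansion_imp_continuous[OF S, of UNIV] by (simp add: continuous_within)
  ultimately have "eval_fps S 0 = 0"
    using LIM_unique by blast
  then show False using nz by (simp add: eval_fps_at_0)
qed

lemma has_sum_product:
  fixes a :: "'a \<Rightarrow> real" and b :: "'b \<Rightarrow> real"
  assumes A: "(a has_sum x) UNIV" and B: "(b has_sum y) UNIV"
  shows "((\<lambda>(i, j). a i * b j) has_sum x * y) (UNIV \<times> UNIV)"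
proof -
  have aA: "(\<lambda>i. \<bar>a i\<bar>) summable_on UNIV" and aB: "(\<lambda>j. \<bar>b j\<bar>) summable_on UNIV"
    using summable_on_iff_abs_summable_on_real[THEN iffD1, OF has_sum_imp_summable, OF A]
      summable_on_iff_abs_summable_on_real[THEN iffD1, OF has_sum_imp_summable, OF B] by simp_all
  have "(\<lambda>(i, j). \<bar>a i\<bar> * \<bar>b j\<bar>) summable_on UNIV \<times> UNIV"
    by (rule summable_on_SigmaI[where g = "\<lambda>i. \<bar>a i\<bar> * infsum (\<lambda>j. \<bar>b j\<bar>) UNIV"])
       (use aA aB in \<open>auto intro!: has_sum_cmult_right summable_on_cmult_left\<close>)
  then have "(\<lambda>p. norm (case p of (i, j) \<Rightarrow> a i * b j)) summable_on UNIV \<times> UNIV"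
    by (rule summable_on_cong[THEN iffD1, rotated]) (auto simp: abs_mult)
  then have S: "(\<lambda>(i, j). a i * b j) summable_on UNIV \<times> UNIV"
    by (rule abs_summable_summable)
  show ?thesis
    by (rule has_sum_SigmaI[where g = "\<lambda>i. a i * y"])
       (use A B S in \<open>auto intro!: has_sum_cmult_right has_sum_cmult_left\<close>)
qed

lemma real_analytic_atE:
  assumes "real_analytic_at f X0"
  obtains c \<rho> where "\<rho> > 0" "\<And>X. X \<in> ball X0 \<rho> \<Longrightarrow> ((\<lambda>\<alpha>. c \<alpha> * monomial (X - X0) \<alpha>) has_sum f X) UNIV"
proof -
  from assms obtain c \<rho> where "\<rho> > 0" "\<forall>X\<in>ball X0 \<rho>. ((\<lambda>\<alpha>. c \<alpha> * monomial (X - X0) \<alpha>) has_sum f X) UNIV"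
    unfolding real_analytic_at_def by blast
  then show ?thesis using that by blast
qed

lemma real_analytic_at_mult:
  fixes X0 :: "('m::finite, 'n::finite) rmat"
  assumes "real_analytic_at f X0" "real_analytic_at g X0"
  shows "real_analytic_at (\<lambda>X. f X * g X) X0"
proof -
  obtain c \<rho> where c: "\<rho> > 0" "\<And>X. X \<in> ball X0 \<rho> \<Longrightarrow> ((\<lambda>\<alpha>. c \<alpha> * monomial (X - X0) \<alpha>) has_sum f X) UNIV"
    by (rule real_analytic_atE[OF assms(1)]) blast
  obtain d \<sigma> where d: "\<sigma> > 0" "\<And>X. X \<in> ball X0 \<sigma> \<Longrightarrow> ((\<lambda>\<alpha>. d \<alpha> * monomial (X - X0) \<alpha>) has_sum g X) UNIV"
    by (rule real_analytic_atE[OF assms(2)]) blast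
  define fib where "fib \<gamma> = {(\<alpha>, \<beta>). (\<lambda>i j. \<alpha> i j + \<beta> i j) = (\<gamma> :: 'm \<Rightarrow> 'n \<Rightarrow> nat)}" for \<gamma>
  define e where "e \<gamma> = (\<Sum>\<^sub>\<infinity>(\<alpha>, \<beta>)\<in>fib \<gamma>. c \<alpha> * d \<beta>)" for \<gamma>
  have "((\<lambda>\<gamma>. e \<gamma> * monomial (X - X0) \<gamma>) has_sum f X * g X) UNIV" if X: "X \<in> ball X0 (min \<rho> \<sigma>)" for X
  proof -
    let ?M = "monomial (X - X0)"
    let ?t = "\<lambda>(\<alpha>, \<beta>). (c \<alpha> * ?M \<alpha>) * (d \<beta> * ?M \<beta>)"
    have F: "((\<lambda>\<alpha>. c \<alpha> * ?M \<alpha>) has_sum f X) UNIV" and G: "((\<lambda>\<alpha>. d \<alpha> * ?M \<alpha>) has_sum g X) UNIV"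
      using X c d by auto
    have T: "(?t has_sum f X * g X) (UNIV \<times> UNIV)"
      by (rule has_sum_product[OF F G])
    then have S: "?t summable_on UNIV \<times> UNIV"
      by (rule has_sum_imp_summable)
    let ?s = "\<lambda>(\<gamma>, \<alpha>, \<beta>). ?t (\<alpha>, \<beta>)"
    have bij: "bij_betw snd (Sigma UNIV fib) (UNIV \<times> UNIV)"
      by (rule bij_betw_byWitness[where f' = "\<lambda>(\<alpha>, \<beta>). ((\<lambda>i j. \<alpha> i j + \<beta> i j), \<alpha>, \<beta>)"]) (auto simp: fib_def)
    have "((\<lambda>x. ?t (snd x)) has_sum f X * g X) (Sigma UNIV fib)"
      using has_sum_reindex_bij_betw[OF bij, of ?t] T by simp
    then have T': "(?s has_sum f X * g X) (Sigma UNIV fib)"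
      by (rule has_sum_cong[THEN iffD1, rotated]) auto
    show ?thesis
    proof (rule has_sum_SigmaD[OF T'])
      fix \<gamma>
      have "?t summable_on fib \<gamma>"
        by (rule summable_on_subset_banach[OF S]) auto
      then have "(?t has_sum infsum ?t (fib \<gamma>)) (fib \<gamma>)"
        by (rule has_sum_infsum)
      also have "infsum ?t (fib \<gamma>) = infsum (\<lambda>p. (\<lambda>(\<alpha>, \<beta>). c \<alpha> * d \<beta>) p * ?M \<gamma>) (fib \<gamma>)"
        by (rule infsum_cong) (auto simp: fib_def power_add prod.distrib)
      also have "\<dots> = e \<gamma> * ?M \<gamma>"
        unfolding e_def by (rule infsum_cmult_left')
      finally show "((\<lambda>p. ?s (\<gamma>, p)) has_sum e \<gamma> * ?M \<gamma>) (fib \<gamma>)"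
        by simp
    qed
  qed
  then show ?thesis
    unfolding real_analytic_at_def using c(1) d(1)
    by (intro exI[of _ e] exI[of _ "min \<rho> \<sigma>"]) auto
qed

lemma real_analytic_at_add:
  assumes "real_analytic_at f X0" "real_analytic_at g X0"
  shows "real_analytic_at (\<lambda>X. f X + g X) X0"
proof -
  obtain c \<rho> where c: "\<rho> > 0" "\<And>X. X \<in> ball X0 \<rho> \<Longrightarrow> ((\<lambda>\<alpha>. c \<alpha> * monomial (X - X0) \<alpha>) has_sum f X) UNIV"
    by (rule real_analytic_atE[OF assms(1)]) blast
  obtain d \<sigma> where d: "\<sigma> > 0" "\<And>X. X \<in> ball X0 \<sigma> \<Longrightarrow> ((\<lambda>\<alpha>. d \<alpha> * monomial (X - X0) \<alpha>) has_sum g X) UNIV"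
    by (rule real_analytic_atE[OF assms(2)]) blast
  have "((\<lambda>\<alpha>. (c \<alpha> + d \<alpha>) * monomial (X - X0) \<alpha>) has_sum f X + g X) UNIV" if "X \<in> ball X0 (min \<rho> \<sigma>)" for X
    using has_sum_add[OF c(2) d(2), of X X] that by (simp add: algebra_simps)
  then show ?thesis
    unfolding real_analytic_at_def using c(1) d(1)
    by (intro exI[of _ "\<lambda>\<alpha>. c \<alpha> + d \<alpha>"] exI[of _ "min \<rho> \<sigma>"]) auto
qed

lemma real_analytic_at_const: "real_analytic_at (\<lambda>X. a) X0"
proof -
  have "((\<lambda>\<alpha>. (if \<alpha> = (\<lambda>i j. 0) then a else 0) * monomial (X - X0) \<alpha>) has_sum a) UNIV" for X
    by (rule has_sum_finite_neutralI[where B = "{\<lambda>i j. 0}"]) auto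
  then show ?thesis
    unfolding real_analytic_at_def
    by (intro exI[of _ "\<lambda>\<alpha>. if \<alpha> = (\<lambda>i j. 0) then a else 0"] exI[of _ 1]) auto
qed

lemma real_analytic_at_entry: "real_analytic_at (\<lambda>X. X $ i $ j) X0"
proof -
  let ?u = "\<lambda>i' j'. if i' = i \<and> j' = j then 1 else (0::nat)"
  let ?c = "\<lambda>\<alpha>. if \<alpha> = ?u then 1 else (0::real)"
  have 1: "monomial Y ?u = Y $ i $ j" for Y
  proof -
    have "monomial Y ?u = (\<Prod>i'\<in>UNIV. if i' = i then Y $ i $ j else 1)"
      by (intro prod.cong refl) (auto simp: if_distrib[of "\<lambda>n. _ ^ n"] cong: if_cong)
    then show ?thesis by simp
  qed
  have "((\<lambda>\<alpha>. ?c \<alpha> * monomial (X - X0) \<alpha>) has_sum (X - X0) $ i $ j) UNIV" for X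
    using 1[of "X - X0"] by (intro has_sum_finite_neutralI[where B = "{?u}"]) auto
  then have "real_analytic_at (\<lambda>X. (X - X0) $ i $ j) X0"
    unfolding real_analytic_at_def
    by (intro exI[of _ ?c] exI[of _ 1]) auto
  from real_analytic_at_add[OF this real_analytic_at_const[of "X0 $ i $ j"]]
  show ?thesis by simp
qed

lemma real_analytic_at_sum: "(\<And>a. a \<in> A \<Longrightarrow> real_analytic_at (f a) X0) \<Longrightarrow> real_analytic_at (\<lambda>X. \<Sum>a\<in>A. f a X) X0"
  by (induction A rule: infinite_finite_induct) (auto intro: real_analytic_at_const real_analytic_at_add)

lemma real_analytic_at_prod: "(\<And>a. a \<in> A \<Longrightarrow> real_analytic_at (f a) X0) \<Longrightarrow> real_analytic_at (\<lambda>X. \<Prod>a\<in>A. f a X) X0"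
  by (induction A rule: infinite_finite_induct) (auto intro: real_analytic_at_const real_analytic_at_mult)

lemma real_analytic_at_minor: 
  fixes X0 :: "('m::{finite,linorder}, 'n::{finite,linorder}) rmat"
  assumes "card A = card B"
  shows "real_analytic_at (minor A B) X0"
proof -
  have [simp]: "Matrix.dim_row (Matrix.mat m n F) = m" "Matrix.dim_col (Matrix.mat m n F) = n" for m n and F :: "nat \<times> nat \<Rightarrow> real"
    by auto
  have "minor A B X = (\<Sum>p\<in>{p. p permutes {0..<card B}}. signof p * (\<Prod>i\<in>{0..<card B}.
          X $ (sorted_list_of_set A ! i) $ (sorted_list_of_set B ! p i)))" for X :: "('m, 'n) rmat"
    unfolding minor_def Determinant.det_def using assms
    by (auto intro!: sum.cong prod.cong dest: permutes_in_image)
  then have "minor A B = (\<lambda>X :: ('m, 'n) rmat. \<Sum>p\<in>{p. p permutes {0..<card B}}. signof p * (\<Prod>i\<in>{0..<card B}.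
          X $ (sorted_list_of_set A ! i) $ (sorted_list_of_set B ! p i)))" 
    by blast
  then show ?thesis
    by (auto intro!: real_analytic_at_sum real_analytic_at_mult real_analytic_at_prod
          real_analytic_at_const real_analytic_at_entry)
qed

lemma real_analytic_at_Q: "real_analytic_at (Q j) X0"
  unfolding Q_def [abs_def] power2_eq_square
  by (intro real_analytic_at_sum real_analytic_at_mult real_analytic_at_minor) auto

lemma cring_analytic_functions:
  fixes X0 :: "('m::finite, 'n::finite) rmat"
  shows "cring (analytic_functions X0)"
proof (intro cringI abelian_groupI comm_monoidI; (simp add: analytic_functions_def)?)
  fix f g :: "('m, 'n) rmat \<Rightarrow> real"
  assume "real_analytic_at f X0"
  then have "real_analytic_at (\<lambda>X. (-1) * f X) X0"
    by (intro real_analytic_at_mult real_analytic_at_const)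
  then show "\<exists>g. real_analytic_at g X0 \<and> (\<lambda>X. g X + f X) = (\<lambda>X. 0)"
    by (intro exI[of _ "\<lambda>X. (-1) * f X"]) auto
qed (auto intro: real_analytic_at_add real_analytic_at_mult real_analytic_at_const simp: algebra_simps)

lemma ideal_null_functions: "ideal (null_functions X0) (analytic_functions X0)"
proof -
  interpret R: cring "analytic_functions X0" by (rule cring_analytic_functions)
  have m: "f \<otimes>\<^bsub>analytic_functions X0\<^esub> g \<in> null_functions X0"
    if "f \<in> null_functions X0" "g \<in> carrier (analytic_functions X0)" for f g
    using that unfolding null_functions_def analytic_functions_def
    by (auto intro: real_analytic_at_mult elim: eventually_mono)
  show ?thesis
  proof (rule idealI[OF R.ring_axioms])
    show "subgroup (null_functions X0) (add_monoid (analytic_functions X0))"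
    proof (rule group.subgroupI[OF R.a_group])
      show "null_functions X0 \<subseteq> carrier (add_monoid (analytic_functions X0))"
        by (auto simp: null_functions_def analytic_functions_def)
      show "null_functions X0 \<noteq> {}"
        by (auto simp: null_functions_def intro!: exI[of _ "\<lambda>X. 0"] real_analytic_at_const)
      show "f \<otimes>\<^bsub>add_monoid (analytic_functions X0)\<^esub> g \<in> null_functions X0"
        if "f \<in> null_functions X0" "g \<in> null_functions X0" for f g
        using that unfolding null_functions_def analytic_functions_def
        by (auto intro: real_analytic_at_add elim: eventually_elim2)
      show "inv\<^bsub>add_monoid (analytic_functions X0)\<^esub> f \<in> null_functions X0" if f: "f \<in> null_functions X0" for f
      proof -
        have fc: "f \<in> carrier (analytic_functions X0)"
          using f by (auto simp: null_functions_def analytic_functions_def)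
        have "f \<otimes>\<^bsub>analytic_functions X0\<^esub> (\<ominus>\<^bsub>analytic_functions X0\<^esub> \<one>\<^bsub>analytic_functions X0\<^esub>) = \<ominus>\<^bsub>analytic_functions X0\<^esub> f"
          using fc by (simp add: R.r_minus)
        moreover have "\<ominus>\<^bsub>analytic_functions X0\<^esub> \<one>\<^bsub>analytic_functions X0\<^esub> \<in> carrier (analytic_functions X0)"
          by simp
        ultimately have "\<ominus>\<^bsub>analytic_functions X0\<^esub> f \<in> null_functions X0"
          using m[OF f] by metis
        then show ?thesis
          by (simp add: a_inv_def)
      qed
    qed
    show "f \<otimes>\<^bsub>analytic_functions X0\<^esub> g \<in> null_functions X0"
      if "g \<in> null_functions X0" "f \<in> carrier (analytic_functions X0)" for f g
      using m[OF that] that ideal.axioms R.m_comm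
      by (metis (no_types, lifting) R.m_comm mem_Collect_eq null_functions_def partial_object.select_convs(1) analytic_functions_def)
  qed (rule m)
qed

lemma cring_germ_ring: "cring (germ_ring X0)"
  unfolding germ_ring_def by (rule ideal.quotient_is_cring[OF ideal_null_functions cring_analytic_functions])

lemma mem_germ_iff:
  assumes "real_analytic_at f X0"
  shows "g \<in> germ X0 f \<longleftrightarrow> real_analytic_at g X0 \<and> (\<forall>\<^sub>F X in nhds X0. g X = f X)"
proof -
  have "g \<in> germ X0 f \<longleftrightarrow> (\<exists>h. h \<in> null_functions X0 \<and> g = (\<lambda>X. h X + f X))"
    by (auto simp: germ_def a_r_coset_def r_coset_def analytic_functions_def)
  also have "\<dots> \<longleftrightarrow> real_analytic_at g X0 \<and> (\<forall>\<^sub>F X in nhds X0. g X = f X)"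
  proof safe
    fix h assume h: "h \<in> null_functions X0"
    then show "real_analytic_at (\<lambda>X. h X + f X) X0"
      using assms by (auto simp: null_functions_def intro: real_analytic_at_add)
    show "\<forall>\<^sub>F X in nhds X0. h X + f X = f X"
      using h by (auto simp: null_functions_def)
  next
    assume g: "real_analytic_at g X0" "\<forall>\<^sub>F X in nhds X0. g X = f X"
    have "real_analytic_at (\<lambda>X. g X + (-1) * f X) X0"
      by (intro real_analytic_at_add real_analytic_at_mult real_analytic_at_const g assms)
    then have "(\<lambda>X. g X + (-1) * f X) \<in> null_functions X0"
      using g by (auto simp: null_functions_def)
    then show "\<exists>h. h \<in> null_functions X0 \<and> g = (\<lambda>X. h X + f X)"
      by (intro exI[of _ "\<lambda>X. g X + (-1) * f X"]) auto
  qed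
  finally show ?thesis .
qed

lemma carrier_germ_ring: "carrier (germ_ring X0) = germ X0 ` {f. real_analytic_at f X0}"
  by (auto simp: germ_ring_def FactRing_def A_RCOSETS_def RCOSETS_def germ_def a_r_coset_def analytic_functions_def)

lemma Q_0: "Q 0 X = 1"
  by (simp add: Q_def minor_def Determinant.det_def)

lemma minors_ideal_0:
  fixes X0 :: "('m::{finite,linorder}, 'n::{finite,linorder}) rmat"
  shows "minors_ideal X0 0 = carrier (germ_ring X0)"
proof -
  interpret R: cring "germ_ring X0" by (rule cring_germ_ring)
  have "minor {} {} = (\<lambda>X :: ('m, 'n) rmat. 1)"
    by (auto simp: minor_def Determinant.det_def)
  then have "{germ X0 (minor A B) |A B. card A = 0 \<and> card B = 0} = {\<one>\<^bsub>germ_ring X0\<^esub>}"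
    by (auto simp: germ_ring_def FactRing_def germ_def analytic_functions_def)
  then show ?thesis
    by (simp add: minors_ideal_def R.genideal_one)
qed


subsection \<open>The order of an ideal along an arc is that of any generating set\<close>

lemma analytic_arc_comp:
  fixes X0 :: "('m::finite, 'n::finite) rmat"
  assumes "real_analytic_at f X0" "analytic_arc X0 \<gamma>"
  shows "\<exists>F. (f \<circ> \<gamma>) has_fps_expansion F"
proof -
  obtain c \<rho> where c: "\<rho> > 0" "\<And>X. X \<in> ball X0 \<rho> \<Longrightarrow> ((\<lambda>\<alpha>. c \<alpha> * monomial (X - X0) \<alpha>) has_sum f X) UNIV"
    by (rule real_analytic_atE[OF assms(1)]) blast
  obtain G where G: "\<And>i j. (\<lambda>t. \<gamma> t $ i $ j) has_fps_expansion G i j"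
    using assms(2) unfolding analytic_arc_def by metis
  have \<gamma>0: "\<gamma> 0 = X0"
    using assms(2) by (simp add: analytic_arc_def)
  define D where "D i j = G i j - fps_const (X0 $ i $ j)" for i j
  have D: "(\<lambda>t. (\<gamma> t - X0) $ i $ j) has_fps_expansion D i j" for i j
    unfolding D_def vector_minus_component by (intro fps_expansion_intros G)
  define cD where "cD i j = Abs_fps (\<lambda>n. complex_of_real (fps_nth (D i j) n))" for i j
  have rad: "fps_conv_radius (cD i j) = fps_conv_radius (D i j)" for i j
    by (simp add: fps_conv_radius_def conv_radius_def cD_def)
  have rpos: "fps_conv_radius (cD i j) > 0" for i j
    using D by (simp add: rad has_fps_expansion_def)
  define e where "e i j = eval_fps (cD i j)" for i j
  have eD: "e i j (of_real t) = of_real (eval_fps (D i j) t)" if "norm t < fps_conv_radius (D i j)" for i j t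
  proof -
    have "(\<lambda>n. complex_of_real (fps_nth (D i j) n * t ^ n)) sums of_real (eval_fps (D i j) t)"
      using sums_eval_fps[OF that] by (rule sums_of_real)
    then show ?thesis
      by (simp add: e_def eval_fps_def cD_def sums_iff)
  qed
  have e0: "e i j 0 = 0" for i j
  proof -
    have "eval_fps (D i j) 0 = 0"
      using D[of i j] eventually_nhds_x_imp_x unfolding has_fps_expansion_def \<gamma>0[symmetric] by fastforce
    then show ?thesis using eD[of 0 i j] rpos[of i j] by (simp add: rad zero_ereal_def)
  qed
  define P :: "('m, 'n) rmat" where "P = (\<chi> i j. 1)"
  define \<delta> where "\<delta> = \<rho> / (2 * (norm P + 1))"
  have \<delta>: "\<delta> > 0" using c(1) by (simp add: \<delta>_def add_nonneg_pos)
  have "norm (\<delta> *\<^sub>R P) < \<rho>"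
  proof -
    have "norm (\<delta> *\<^sub>R P) = \<rho> * (norm P / (2 * (norm P + 1)))"
      using c(1) by (simp add: \<delta>_def)
    also have "\<dots> < \<rho> * 1"
      using c(1) norm_ge_zero[of P]
      by (intro mult_strict_left_mono, subst pos_divide_less_eq) (auto intro: add_nonneg_pos)
    finally show ?thesis by simp
  qed
  then have "((\<lambda>\<alpha>. c \<alpha> * monomial (X0 + \<delta> *\<^sub>R P - X0) \<alpha>) has_sum f (X0 + \<delta> *\<^sub>R P)) UNIV"
    by (intro c(2)) (auto simp: dist_norm)
  then have "(\<lambda>\<alpha>. c \<alpha> * monomial (X0 + \<delta> *\<^sub>R P - X0) \<alpha>) summable_on UNIV"
    by (rule has_sum_imp_summable)
  then have M: "(\<lambda>\<alpha>. \<bar>c \<alpha> * (\<Prod>i\<in>UNIV. \<Prod>j\<in>UNIV. \<delta> ^ \<alpha> i j)\<bar>) summable_on UNIV"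
    by (drule_tac summable_on_iff_abs_summable_on_real[THEN iffD1]) (simp add: P_def)
  have "\<forall>\<^sub>F z in nhds 0. \<forall>i j. norm (e i j z) \<le> \<delta> \<and> z \<in> eball 0 (fps_conv_radius (cD i j))"
  proof (intro eventually_all_finite eventually_conj)
    fix i j
    have "eventually (\<lambda>z. z \<in> eball 0 (fps_conv_radius (cD i j))) (nhds 0)"
      using rpos[of i j] by (intro eventually_nhds_in_open) (auto simp: zero_ereal_def)
    then show "\<forall>\<^sub>F z in nhds 0. z \<in> eball 0 (fps_conv_radius (cD i j))" .
    have "e i j has_fps_expansion cD i j"
      unfolding e_def using rpos by (rule eval_fps_has_fps_expansion)
    then have "isCont (e i j) 0"
      using has_fps_expansion_imp_continuous by blast
    then have "(e i j \<longlongrightarrow> 0) (nhds 0)"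
      unfolding isCont_def using e0 by (metis tendsto_at_iff_tendsto_nhds)
    then have "\<forall>\<^sub>F z in nhds 0. dist (e i j z) 0 < \<delta>"
      using \<delta> by (simp add: tendsto_iff)
    then show "\<forall>\<^sub>F z in nhds 0. norm (e i j z) \<le> \<delta>"
      by eventually_elim simp
  qed
  then obtain r where r0: "r > 0"
      "\<And>z. dist z 0 \<le> r \<Longrightarrow> \<forall>i j. norm (e i j z) \<le> \<delta> \<and> z \<in> eball 0 (fps_conv_radius (cD i j))"
    unfolding eventually_nhds_metric_le by blast
  then have r: "r > 0" "\<And>z i j. z \<in> cball 0 r \<Longrightarrow> norm (e i j z) \<le> \<delta>"
      "\<And>i j. cball (0::complex) r \<subseteq> eball 0 (fps_conv_radius (cD i j))"
    unfolding subset_iff mem_cball by (metis dist_commute)+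
  define T where "T \<alpha> z = of_real (c \<alpha>) * (\<Prod>i\<in>UNIV. \<Prod>j\<in>UNIV. e i j z ^ \<alpha> i j)" for \<alpha> and z :: complex
  define Z where "Z z = (\<Sum>\<^sub>\<infinity>\<alpha>. T \<alpha> z)" for z
  have holT: "T \<alpha> holomorphic_on cball 0 r" for \<alpha>
    unfolding T_def e_def by (intro holomorphic_intros r)
  have ul: "uniform_limit (cball 0 r) (\<lambda>A z. \<Sum>\<alpha>\<in>A. T \<alpha> z) Z (finite_subsets_at_top UNIV)"
    unfolding Z_def
  proof (rule Weierstrass_m_test_general[OF _ M])
    fix \<alpha> and z :: complex assume "z \<in> cball 0 r"
    then have "(\<Prod>i\<in>UNIV. \<Prod>j\<in>UNIV. norm (e i j z) ^ \<alpha> i j) \<le> (\<Prod>i\<in>UNIV. \<Prod>j\<in>UNIV. \<delta> ^ \<alpha> i j)"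
      by (intro prod_mono conjI power_mono r prod_nonneg) auto
    then show "norm (T \<alpha> z) \<le> \<bar>c \<alpha> * (\<Prod>i\<in>UNIV. \<Prod>j\<in>UNIV. \<delta> ^ \<alpha> i j)\<bar>"
      using \<delta> unfolding T_def norm_mult abs_mult
      by (intro mult_mono) (auto simp: prod_norm[symmetric] norm_power abs_prod power_abs intro!: prod_nonneg)
  qed
  have hA: "continuous_on (cball 0 r) (\<lambda>z. \<Sum>\<alpha>\<in>A. T \<alpha> z) \<and> (\<lambda>z. \<Sum>\<alpha>\<in>A. T \<alpha> z) holomorphic_on ball 0 r" for A
    using holomorphic_on_imp_continuous_on[OF holT] holomorphic_on_subset[OF holT ball_subset_cball]
    by (intro conjI continuous_on_sum holomorphic_on_sum) auto
  have "Z holomorphic_on ball 0 r"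
    by (rule holomorphic_uniform_limit[OF _ ul]) (use hA in auto)
  then have FZ: "Z has_fps_expansion fps_expansion Z 0"
    using r(1) by (intro has_fps_expansion_fps_expansion[of "ball 0 r"]) auto
  define FZ where "FZ = fps_expansion Z 0"
  define F where "F = Abs_fps (\<lambda>n. Re (fps_nth FZ n))"
  have FZ': "fps_conv_radius FZ > 0" "\<forall>\<^sub>F z in nhds 0. eval_fps FZ z = Z z"
    using FZ by (auto simp: FZ_def has_fps_expansion_def)
  have radF: "fps_conv_radius F \<ge> fps_conv_radius FZ"
    unfolding fps_conv_radius_def conv_radius_def
  proof (rule ereal_inverse_antimono)
    show "0 \<le> limsup (\<lambda>n. ereal (root n (norm (fps_nth F n))))"
      by (rule le_Limsup) (auto intro!: always_eventually real_root_ge_zero)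
    have "root n (norm (fps_nth F n)) \<le> root n (norm (fps_nth FZ n))" for n
      by (cases "n = 0") (auto simp: F_def abs_Re_le_cmod)
    then show "limsup (\<lambda>n. ereal (root n (norm (fps_nth F n)))) \<le> limsup (\<lambda>n. ereal (root n (norm (fps_nth FZ n))))"
      by (intro Limsup_mono) (auto intro!: always_eventually)
  qed
  have ofr: "filterlim complex_of_real (nhds 0) (nhds 0)"
    using tendsto_of_real[of "\<lambda>x::real. x" 0 "nhds 0"] by (simp add: filterlim_ident)
  have 1: "\<forall>\<^sub>F t in nhds 0. eval_fps FZ (of_real t) = Z (of_real t)"
    using eventually_compose_filterlim[OF FZ'(2) ofr] .
  have "\<forall>\<^sub>F z in nhds 0. z \<in> eball (0::complex) (fps_conv_radius FZ)"
    using FZ'(1) by (intro eventually_nhds_in_open) (auto simp: zero_ereal_def)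
  then have 2: "\<forall>\<^sub>F t in nhds 0. complex_of_real t \<in> eball 0 (fps_conv_radius FZ)"
    using ofr by (rule eventually_compose_filterlim)
  have "\<forall>\<^sub>F t in nhds 0. \<forall>i j. eval_fps (D i j) t = (\<gamma> t - X0) $ i $ j"
    using D by (intro eventually_all_finite) (auto simp: has_fps_expansion_def)
  moreover have "\<forall>\<^sub>F t in nhds 0. \<forall>i j. norm t < fps_conv_radius (D i j)"
  proof (intro eventually_all_finite)
    fix i j
    have "eventually (\<lambda>t. t \<in> eball 0 (fps_conv_radius (D i j))) (nhds 0)"
      using rpos[of i j] by (intro eventually_nhds_in_open) (auto simp: rad zero_ereal_def)
    then show "\<forall>\<^sub>F t in nhds 0. norm t < fps_conv_radius (D i j)" by eventually_elim simp
  qed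
  ultimately have 3: "\<forall>\<^sub>F t in nhds 0. \<forall>i j. e i j (of_real t) = of_real ((\<gamma> t - X0) $ i $ j)"
    by eventually_elim (simp add: eD)
  have "((\<lambda>t. \<gamma> t) \<longlongrightarrow> \<gamma> 0) (nhds 0)"
  proof (intro vec_tendstoI)
    fix i j
    have "isCont (\<lambda>t. \<gamma> t $ i $ j) 0"
      using has_fps_expansion_imp_continuous[OF G] by blast
    then show "((\<lambda>t. \<gamma> t $ i $ j) \<longlongrightarrow> \<gamma> 0 $ i $ j) (nhds 0)"
      unfolding isCont_def by (metis tendsto_at_iff_tendsto_nhds)
  qed
  then have 4: "\<forall>\<^sub>F t in nhds 0. dist (\<gamma> t) X0 < \<rho>"
    using c(1) unfolding \<gamma>0 by (rule tendstoD)
  have "\<forall>\<^sub>F t in nhds 0. eval_fps F t = (f \<circ> \<gamma>) t"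
    using 1 2 3 4
  proof eventually_elim
    case (elim t)
    have "((\<lambda>\<alpha>. complex_of_real (c \<alpha> * monomial (\<gamma> t - X0) \<alpha>)) has_sum of_real (f (\<gamma> t))) UNIV"
      using elim(4) by (intro has_sum_of_real c(2)) (simp add: dist_commute)
    then have "Z (of_real t) = of_real (f (\<gamma> t))"
      unfolding Z_def T_def using elim(3) by (intro infsumI) simp
    moreover have "(\<lambda>n. fps_nth FZ n * of_real t ^ n) sums eval_fps FZ (of_real t)"
      using elim(2) by (intro sums_eval_fps) simp
    ultimately have "(\<lambda>n. Re (fps_nth FZ n * of_real t ^ n)) sums Re (of_real (f (\<gamma> t)))"
      using elim(1) by (intro sums_Re) simp
    then show ?case
      by (simp add: eval_fps_def F_def sums_iff flip: of_real_power)
  qed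
  then show ?thesis
    using radF FZ'(1) unfolding has_fps_expansion_def by (intro exI[of _ F]) auto
qed

lemma vanishing_order_eq:
  assumes "f has_fps_expansion F"
  shows "vanishing_order f = (if F = 0 then \<infinity> else enat (subdegree F))"
proof -
  have "(THE F. f has_fps_expansion F) = F"
    using assms real_fps_expansion_unique by blast
  then show ?thesis by (simp add: vanishing_order_def Let_def)
qed

lemma vanishing_order_mult:
  assumes "f has_fps_expansion F" "g has_fps_expansion G"
  shows "vanishing_order (\<lambda>t. f t * g t) = vanishing_order f + vanishing_order g"
  using vanishing_order_eq[OF has_fps_expansion_mult[OF assms]] vanishing_order_eq[OF assms(1)]
    vanishing_order_eq[OF assms(2)] by auto

lemma vanishing_order_add:
  assumes "f has_fps_expansion F" "g has_fps_expansion G"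
  shows "vanishing_order (\<lambda>t. f t + g t) \<ge> min (vanishing_order f) (vanishing_order g)"
  using vanishing_order_eq[OF has_fps_expansion_add[OF assms]] vanishing_order_eq[OF assms(1)]
    vanishing_order_eq[OF assms(2)] subdegree_add_ge'[of F G]
  by (auto simp: min_def)

lemma vanishing_order_germ_cong:
  assumes \<gamma>: "analytic_arc X0 \<gamma>" and f: "real_analytic_at f X0" and g: "g \<in> germ X0 f"
  shows "vanishing_order (g \<circ> \<gamma>) = vanishing_order (f \<circ> \<gamma>)"
proof -
  have "(\<gamma> \<longlongrightarrow> \<gamma> 0) (nhds 0)"
  proof (intro vec_tendstoI)
    fix i j
    obtain F where "(\<lambda>t. \<gamma> t $ i $ j) has_fps_expansion F"
      using \<gamma> by (auto simp: analytic_arc_def)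
    then have "isCont (\<lambda>t. \<gamma> t $ i $ j) 0"
      by (rule has_fps_expansion_imp_continuous)
    then show "((\<lambda>t. \<gamma> t $ i $ j) \<longlongrightarrow> \<gamma> 0 $ i $ j) (nhds 0)"
      unfolding isCont_def by (metis tendsto_at_iff_tendsto_nhds)
  qed
  then have "filterlim \<gamma> (nhds X0) (nhds 0)"
    using \<gamma> by (simp add: analytic_arc_def)
  with g f have ev: "\<forall>\<^sub>F t in nhds 0. g (\<gamma> t) = f (\<gamma> t)"
    by (auto simp: mem_germ_iff dest: eventually_compose_filterlim)
  obtain F where F: "(f \<circ> \<gamma>) has_fps_expansion F"
    using analytic_arc_comp[OF f \<gamma>] by blast
  moreover have "(g \<circ> \<gamma>) has_fps_expansion F"
    using F ev unfolding has_fps_expansion_def by (auto elim: eventually_elim2)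
  ultimately show ?thesis by (simp add: vanishing_order_eq)
qed

lemma germ_add:
  assumes "real_analytic_at f X0" "real_analytic_at g X0"
  shows "germ X0 f \<oplus>\<^bsub>germ_ring X0\<^esub> germ X0 g = germ X0 (\<lambda>X. f X + g X)"
proof -
  interpret N: ideal "null_functions X0" "analytic_functions X0" by (rule ideal_null_functions)
  show ?thesis
    using N.a_rcos_sum[of f g] assms by (simp add: germ_ring_def FactRing_def germ_def analytic_functions_def)
qed

lemma germ_mult:
  assumes "real_analytic_at f X0" "real_analytic_at g X0"
  shows "germ X0 f \<otimes>\<^bsub>germ_ring X0\<^esub> germ X0 g = germ X0 (\<lambda>X. f X * g X)"
proof -
  interpret N: ideal "null_functions X0" "analytic_functions X0" by (rule ideal_null_functions)
  show ?thesis
    using N.rcoset_mult_add[of f g] assms by (simp add: germ_ring_def FactRing_def germ_def analytic_functions_def)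
qed

lemma germ_zero: "\<zero>\<^bsub>germ_ring X0\<^esub> = germ X0 (\<lambda>X. 0)"
  by (auto simp: mem_germ_iff[OF real_analytic_at_const] null_functions_def germ_ring_def FactRing_def)

lemma ge_arc_order_iff:
  "v \<le> arc_order \<gamma> G \<longleftrightarrow> (\<forall>h\<in>G. \<forall>f\<in>h. v \<le> vanishing_order (f \<circ> \<gamma>))"
  by (auto simp: arc_order_def le_INF_iff)

theorem arc_order_genideal:
  assumes \<gamma>: "analytic_arc X0 \<gamma>" and G: "G \<subseteq> carrier (germ_ring X0)"
  shows "arc_order \<gamma> (Idl\<^bsub>germ_ring X0\<^esub> G) = arc_order \<gamma> G"
proof (rule antisym)
  interpret R: cring "germ_ring X0" by (rule cring_germ_ring)
  show "arc_order \<gamma> (Idl\<^bsub>germ_ring X0\<^esub> G) \<le> arc_order \<gamma> G"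
    using R.genideal_self[OF G] unfolding arc_order_def by (rule INF_superset_mono) simp
  define v where "v = arc_order \<gamma> G"
  define J where "J = germ X0 ` {f. real_analytic_at f X0 \<and> v \<le> vanishing_order (f \<circ> \<gamma>)}"
  have exp: "\<exists>F. (\<lambda>t. f (\<gamma> t)) has_fps_expansion F" if "real_analytic_at f X0" for f
    using analytic_arc_comp[OF that \<gamma>] by (simp add: o_def)
  have J_add: "a \<oplus>\<^bsub>germ_ring X0\<^esub> b \<in> J" if "a \<in> J" "b \<in> J" for a b
  proof -
    obtain f g where f: "real_analytic_at f X0" "v \<le> vanishing_order (f \<circ> \<gamma>)" "a = germ X0 f"
      and g: "real_analytic_at g X0" "v \<le> vanishing_order (g \<circ> \<gamma>)" "b = germ X0 g"
      using \<open>a \<in> J\<close> \<open>b \<in> J\<close> by (auto simp: J_def)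
    obtain F H where FH: "(\<lambda>t. f (\<gamma> t)) has_fps_expansion F" "(\<lambda>t. g (\<gamma> t)) has_fps_expansion H"
      using exp[OF f(1)] exp[OF g(1)] by blast
    have "v \<le> min (vanishing_order (\<lambda>t. f (\<gamma> t))) (vanishing_order (\<lambda>t. g (\<gamma> t)))"
      using f(2) g(2) by (simp add: o_def)
    also have "\<dots> \<le> vanishing_order ((\<lambda>X. f X + g X) \<circ> \<gamma>)"
      using vanishing_order_add[OF FH] by (simp only: o_def)
    finally have "v \<le> vanishing_order ((\<lambda>X. f X + g X) \<circ> \<gamma>)" .
    then show ?thesis
      using f g by (auto simp: J_def germ_add intro!: real_analytic_at_add)
  qed
  have J_mult: "b \<otimes>\<^bsub>germ_ring X0\<^esub> a \<in> J" if "a \<in> J" "b \<in> carrier (germ_ring X0)" for a b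
  proof -
    obtain f g where f: "real_analytic_at f X0" "v \<le> vanishing_order (f \<circ> \<gamma>)" "a = germ X0 f"
      and g: "real_analytic_at g X0" "b = germ X0 g"
      using \<open>a \<in> J\<close> \<open>b \<in> carrier _\<close> by (auto simp: J_def carrier_germ_ring)
    obtain F H where FH: "(\<lambda>t. f (\<gamma> t)) has_fps_expansion F" "(\<lambda>t. g (\<gamma> t)) has_fps_expansion H"
      using exp[OF f(1)] exp[OF g(1)] by blast
    have "v \<le> vanishing_order (\<lambda>t. g (\<gamma> t)) + vanishing_order (\<lambda>t. f (\<gamma> t))"
      using f(2) by (simp add: o_def add_increasing)
    then have "v \<le> vanishing_order ((\<lambda>X. g X * f X) \<circ> \<gamma>)"
      using vanishing_order_mult[OF FH(2,1)] by (simp add: o_def)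
    then show ?thesis
      using f g by (auto simp: J_def germ_mult intro!: real_analytic_at_mult)
  qed
  have JR: "J \<subseteq> carrier (germ_ring X0)"
    by (auto simp: J_def carrier_germ_ring)
  have "ideal J (germ_ring X0)"
  proof (rule idealI[OF R.ring_axioms])
    show "subgroup J (add_monoid (germ_ring X0))"
    proof (rule group.subgroupI[OF R.a_group])
      have "(\<lambda>t. 0) has_fps_expansion (0 :: real fps)" by simp
      then have "vanishing_order ((\<lambda>X. 0) \<circ> \<gamma>) = \<infinity>"
        using vanishing_order_eq by (fastforce simp: o_def)
      then show "J \<noteq> {}"
        by (auto simp: J_def intro!: exI[of _ "\<lambda>X. 0"] real_analytic_at_const)
      show "inv\<^bsub>add_monoid (germ_ring X0)\<^esub> a \<in> J" if "a \<in> J" for a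
      proof -
        have "(\<ominus>\<^bsub>germ_ring X0\<^esub> \<one>\<^bsub>germ_ring X0\<^esub>) \<otimes>\<^bsub>germ_ring X0\<^esub> a = \<ominus>\<^bsub>germ_ring X0\<^esub> a"
          using that JR by (auto simp: R.l_minus)
        moreover have "\<ominus>\<^bsub>germ_ring X0\<^esub> \<one>\<^bsub>germ_ring X0\<^esub> \<in> carrier (germ_ring X0)"
          by simp
        ultimately have "\<ominus>\<^bsub>germ_ring X0\<^esub> a \<in> J"
          using J_mult[OF that] by metis
        then show ?thesis by (simp add: a_inv_def)
      qed
    qed (simp_all add: JR J_add)
    show "a \<otimes>\<^bsub>germ_ring X0\<^esub> x \<in> J" if "a \<in> J" "x \<in> carrier (germ_ring X0)" for a x
      using J_mult[OF that] R.m_comm[of a x] subsetD[OF JR that(1)] that(2) by simp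
  qed (rule J_mult)
  moreover have "G \<subseteq> J"
  proof
    fix h assume "h \<in> G"
    then obtain f where f: "real_analytic_at f X0" "h = germ X0 f"
      using G by (auto simp: carrier_germ_ring)
    then have "f \<in> h" by (simp add: mem_germ_iff)
    then have "v \<le> vanishing_order (f \<circ> \<gamma>)"
      using \<open>h \<in> G\<close> ge_arc_order_iff[of v \<gamma> G] by (simp add: v_def)
    then show "h \<in> J" using f by (auto simp: J_def)
  qed
  ultimately have "Idl\<^bsub>germ_ring X0\<^esub> G \<subseteq> J"
    by (rule R.genideal_minimal)
  moreover have "v \<le> vanishing_order (g \<circ> \<gamma>)" if "h \<in> J" "g \<in> h" for g h
  proof -
    obtain f where f: "real_analytic_at f X0" "v \<le> vanishing_order (f \<circ> \<gamma>)" "h = germ X0 f"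
      using \<open>h \<in> J\<close> by (auto simp: J_def)
    then show ?thesis
      using vanishing_order_germ_cong[OF \<gamma> f(1)] \<open>g \<in> h\<close> by simp
  qed
  ultimately show "arc_order \<gamma> G \<le> arc_order \<gamma> (Idl\<^bsub>germ_ring X0\<^esub> G)"
    unfolding ge_arc_order_iff v_def by blast
qed

end

theory Submission
  imports Defs
begin

no_notation fps_nth (infixl "$" 75)
no_notation Matrix.scalar_prod (infix "\<bullet>" 70)

text \<open>Everything follows from two-sided estimates of \<open>Q k\<close> and its gradient. The number \<open>Q k X\<close> is the squared
length of the \<open>k\<close>-th compound matrix of \<open>X\<close>; by Cauchy--Binet it is the sum of the principal \<open>k \<times> k\<close> minors
of the Gram matrix of the columns, and it does not change when \<open>X\<close> is multiplied by an orthogonal matrix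
(\<open>Q_orthogonal_right\<close>). Choose an orthogonal \<open>R\<close> for which the columns of \<open>X ** R\<close> are pairwise orthogonal;
their squared lengths \<open>\<lambda>\<close> are the squared singular values of \<open>X\<close>. Then \<open>Q k X\<close> is the \<open>k\<close>-th elementary
symmetric function of \<open>\<lambda>\<close>, which up to a factor depending only on the size of the matrix is the product \<open>P k\<close> of the \<open>k\<close>
largest \<open>\<lambda>\<close> (\<open>Q_bounds\<close>).

Stretching only the column that belongs to the \<open>k\<close>-th largest \<open>\<lambda>\<close> keeps the columns orthogonal, so the derivative
of \<open>Q k\<close> in this direction can be read off from the elementary symmetric function. It gives
\<open>4 * P k * P (k - 1) \<le> \<parallel>grad (Q k) X\<parallel>\<^sup>2\<close>. In the other direction, the derivative of a minor
is a signed sum of minors of size \<open>k - 1\<close>, whence \<open>\<parallel>grad (Q k) X\<parallel>\<^sup>2 \<le> C * Q (k - 1) X * Q k X\<close>. Hence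
\<open>\<parallel>grad (Q k)\<parallel>\<^sup>2\<close> and \<open>Q (k - 1) * Q k\<close> are comparable on the whole matrix space
(\<open>norm_grad_Q_ge\<close>, \<open>norm_grad_Q_le\<close>).

Integral closures: along an analytic arc comparable functions have the same order, and the order of a sum of squares
is twice the minimal order of the summands. So \<open>Q k\<close> has twice the order of the ideal of \<open>k\<close>-minors, and twice
the order of the Jacobian ideal is the order of \<open>Q (k - 1) * Q k\<close>. Since orders are additive on products of ideals, the two
ideals in each of the two equations have the same order along every arc.

Exponents: let \<open>X0\<close> have rank \<open>s < k\<close>. Near \<open>X0\<close> the \<open>s\<close> largest \<open>\<lambda>\<close> have a product bounded away from 0,
and comparing the others with the \<open>k\<close>-th one gives \<open>(Q k) ^ (k - s - 1) \<le> C * (Q (k - 1)) ^ (k - s)\<close>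
(\<open>Q_interpolation\<close>). With the lower bound of the gradient this makes \<open>1 - 1 / (2 * (k - s))\<close> admissible.
No smaller exponent is admissible because \<open>k - s\<close> of the vanishing singular values can be switched on at unit speed along a
line through \<open>X0\<close>; there \<open>Q k\<close> is of exact order \<open>2 * (k - s)\<close> in the parameter \<open>t\<close>, while the norm of the gradient is
\<open>O(t ^ (2 * (k - s) - 1))\<close>.\<close>

section \<open>Minors for index functions and the Cauchy--Binet formula\<close>

text \<open>The index functions need be neither injective nor monotone. This freedom turns the sum over all row sets in
Cauchy--Binet into a sum over all functions, to which a product of sums expands, and lets cofactors be
minors again.\<close>

definition subdet :: "nat \<Rightarrow> (nat \<Rightarrow> 'm::finite) \<Rightarrow> (nat \<Rightarrow> 'n::finite) \<Rightarrow> ('m, 'n) rmat \<Rightarrow> real" where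
  "subdet k f g X = Determinant.det (Matrix.mat k k (\<lambda>(p, q). X $ f p $ g q))"

abbreviation enum :: "'a::linorder set \<Rightarrow> nat \<Rightarrow> 'a" where
  "enum A \<equiv> (!) (sorted_list_of_set A)"

lemma minor_eq_subdet:
  "card A = k \<Longrightarrow> card B = k \<Longrightarrow> minor A B X = subdet k (enum A) (enum B) X"
  by (simp add: minor_def subdet_def)

lemma subdet_cong:
  assumes "\<And>p. p < k \<Longrightarrow> f p = f' p" "\<And>q. q < k \<Longrightarrow> g q = g' q"
  shows "subdet k f g X = subdet k f' g' X"
  unfolding subdet_def using assms by (intro arg_cong[of _ _ Determinant.det] eq_matI) auto

lemma subdet_expand:
  "subdet k f g X = (\<Sum>p | p permutes {0..<k}. signof p * (\<Prod>i = 0..<k. X $ f (p i) $ g i))"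
  unfolding subdet_def
  by (subst det_col[where n = k])
     (auto intro!: sum.cong prod.cong dest: permutes_in_image simp: lessThan_atLeast0)

lemma subdet_transpose:
  "subdet k g f (Finite_Cartesian_Product.transpose X) = subdet k f g X"
proof -
  have "Matrix.mat k k (\<lambda>(p, q). Finite_Cartesian_Product.transpose X $ g p $ f q)
        = transpose_mat (Matrix.mat k k (\<lambda>(p, q). X $ f p $ g q))"
    by (intro eq_matI) (auto simp: Finite_Cartesian_Product.transpose_def)
  then show ?thesis
    unfolding subdet_def by (simp add: Determinant.det_transpose[of _ k])
qed

lemma subdet_permute_rows:
  assumes "p permutes {0..<k}"
  shows "subdet k (f \<circ> p) g X = signof p * subdet k f g X"
proof -
  let ?A = "Matrix.mat k k (\<lambda>(p, q). X $ f p $ g q)"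
  have "Matrix.mat k k (\<lambda>(i, j). ?A $$ (p i, j)) = Matrix.mat k k (\<lambda>(i, q). X $ (f \<circ> p) i $ g q)"
    using assms by (intro eq_matI) (auto dest: permutes_in_image)
  then show ?thesis
    using det_permute_rows[of ?A k p] assms by (simp add: subdet_def)
qed

lemma subdet_permute_columns:
  assumes "p permutes {0..<k}"
  shows "subdet k f (g \<circ> p) X = signof p * subdet k f g X"
  using subdet_permute_rows[OF assms, of g f "Finite_Cartesian_Product.transpose X"] by (simp add: subdet_transpose)

lemma subdet_eq_0_rows:
  assumes "\<not> inj_on f {0..<k}"
  shows "subdet k f g X = 0"
proof -
  obtain i j where "i < k" "j < k" "i \<noteq> j" "f i = f j"
    using assms by (auto simp: inj_on_def)
  then show ?thesis
    unfolding subdet_def by (intro det_identical_rows[of _ k i j]) (auto intro!: eq_vecI)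
qed

lemma subdet_eq_0_columns: "\<not> inj_on g {0..<k} \<Longrightarrow> subdet k f g X = 0"
  using subdet_eq_0_rows[of g k f "Finite_Cartesian_Product.transpose X"] by (simp add: subdet_transpose)

lemma enum_bij: "finite A \<Longrightarrow> card A = k \<Longrightarrow> bij_betw (enum A) {0..<k} A"
  using bij_betw_nth[of "sorted_list_of_set A" "{..<k}" A]
  by (simp add: lessThan_atLeast0)

lemma inj_on_enum_permute:
  fixes f :: "nat \<Rightarrow> 'a::{finite,linorder}"
  assumes "inj_on f {0..<k}"
  obtains A p where "card A = k" "p permutes {0..<k}" "\<And>i. i < k \<Longrightarrow> f i = enum A (p i)"
proof -
  let ?A = "f ` {0..<k}"
  have card: "card ?A = k" using card_image[OF assms] by simp
  have e: "bij_betw (enum ?A) {0..<k} ?A" using card by (intro enum_bij) auto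
  define p where "p i = (if i \<in> {0..<k} then inv_into {0..<k} (enum ?A) (f i) else i)" for i
  have "bij_betw f {0..<k} ?A" using assms by (simp add: bij_betw_def)
  then have "bij_betw (inv_into {0..<k} (enum ?A) \<circ> f) {0..<k} {0..<k}"
    using bij_betw_inv_into[OF e] by (rule bij_betw_trans)
  then have "bij_betw p {0..<k} {0..<k}"
    by (rule bij_betw_cong[THEN iffD1, rotated]) (simp add: p_def)
  then have "p permutes {0..<k}"
    by (rule bij_imp_permutes) (simp add: p_def)
  moreover have "f i = enum ?A (p i)" if "i < k" for i
    using that bij_betw_inv_into_right[OF e, of "f i"] by (auto simp: p_def)
  ultimately show ?thesis using that[OF card] by blast
qed

text \<open>An injective function on \<open>{0..<k}\<close> is determined by its image and the permutation that sorts it.\<close>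

lemma sum_functions_by_image:
  fixes h :: "(nat \<Rightarrow> 'a::{finite,linorder}) \<Rightarrow> real"
  assumes 0: "\<And>f. \<not> inj_on f {0..<k} \<Longrightarrow> h f = 0"
    and cong: "\<And>f g. (\<And>i. i < k \<Longrightarrow> f i = g i) \<Longrightarrow> h f = h g"
  shows "(\<Sum>f\<in>{0..<k} \<rightarrow>\<^sub>E UNIV. h f) = (\<Sum>A | card A = k. \<Sum>p | p permutes {0..<k}. h (enum A \<circ> p))"
proof -
  let ?P = "{p. p permutes {0..<k}}"
  let ?\<Phi> = "\<lambda>(A, p). restrict (enum A \<circ> p) {0..<k} :: nat \<Rightarrow> 'a"
  let ?I = "{f \<in> {0..<k} \<rightarrow>\<^sub>E UNIV. inj_on f {0..<k}}"
  have bij: "bij_betw ?\<Phi> ({A. card A = k} \<times> ?P) ?I"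
  proof (rule bij_betw_imageI)
    have img: "enum A ` p ` {0..<k} = A" if "card A = k" "p permutes {0..<k}" for A :: "'a set" and p
      using enum_bij[of A k] that by (simp add: permutes_image bij_betw_def)
    show "inj_on ?\<Phi> ({A. card A = k} \<times> ?P)"
    proof (rule inj_onI, clarify)
      fix A A' :: "'a set" and p p'
      assume A: "k = card A" "card A' = card A" and p: "p permutes {0..<card A}" "p' permutes {0..<card A}"
        and eq: "restrict (enum A \<circ> p) {0..<card A} = restrict (enum A' \<circ> p') {0..<card A}"
      have eq': "enum A (p i) = enum A' (p' i)" if "i \<in> {0..<card A}" for i
        using fun_cong[OF eq, of i] that by simp
      then have "enum A ` p ` {0..<card A} = enum A' ` p' ` {0..<card A}"
        by (simp add: image_image)
      then have AA: "A = A'" using img[of A p] img[of A' p'] A p by metis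
      have "p i = p' i" for i
      proof (cases "i \<in> {0..<card A}")
        case True
        have "p i \<in> {0..<card A}" "p' i \<in> {0..<card A}" using True permutes_in_image[OF p(1), of i] permutes_in_image[OF p(2), of i] by simp_all
        moreover have "enum A (p i) = enum A (p' i)" using eq'[OF True] AA by simp
        moreover have "inj_on (enum A) {0..<card A}" using enum_bij[of A "card A"] by (simp add: bij_betw_def)
        ultimately show ?thesis by (metis inj_onD)
      qed (use permutes_not_in[OF p(1), of i] permutes_not_in[OF p(2), of i] in simp)
      then show "A = A' \<and> p = p'" using AA by auto
    qed
    have 1: "?\<Phi> (A, p) \<in> ?I" if "card A = k" "p permutes {0..<k}" for A p
    proof -
      have "inj_on (enum A \<circ> p) {0..<k}"
        using enum_bij[of A k] that
        by (intro comp_inj_on) (auto simp: permutes_image bij_betw_def intro: permutes_inj_on)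
      then show ?thesis by (auto simp: inj_on_def)
    qed
    moreover have "f \<in> ?\<Phi> ` ({A. card A = k} \<times> ?P)" if f: "f \<in> ?I" for f
    proof -
      have "inj_on f {0..<k}" using f by simp
      then obtain A p where A: "card A = k" "p permutes {0..<k}" "\<And>i. i < k \<Longrightarrow> f i = enum A (p i)"
        by (rule inj_on_enum_permute) blast
      have "f = ?\<Phi> (A, p)"
        using f A(3) by (intro PiE_ext[of f "{0..<k}" "\<lambda>_. UNIV"]) auto
      then show ?thesis using A(1,2) by blast
    qed
    ultimately show "?\<Phi> ` ({A. card A = k} \<times> ?P) = ?I" by auto
  qed
  have "(\<Sum>f\<in>{0..<k} \<rightarrow>\<^sub>E UNIV. h f) = (\<Sum>f\<in>?I. h f)"
    by (rule sum.mono_neutral_right) (auto simp: 0 finite_PiE)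
  also have "\<dots> = (\<Sum>x\<in>{A. card A = k} \<times> ?P. h (?\<Phi> x))"
    by (rule sum.reindex_bij_betw[OF bij, symmetric])
  also have "\<dots> = (\<Sum>x\<in>{A. card A = k} \<times> ?P. case x of (A, p) \<Rightarrow> h (enum A \<circ> p))"
    by (intro sum.cong refl) (auto intro!: cong)
  also have "\<dots> = (\<Sum>A | card A = k. \<Sum>p | p permutes {0..<k}. h (enum A \<circ> p))"
    by (simp add: sum.cartesian_product)
  finally show ?thesis .
qed

text \<open>Expanding one of the two equal factors by the Leibniz formula spreads the sum over row sets into a sum over all
functions \<open>f\<close>, the non-injective ones contributing 0. Expanding the other factor then leaves, for every
permutation, a product of inner products of columns.\<close>

lemma cauchy_binet_gram:
  fixes X :: "('m::{finite,linorder}, 'n::finite) rmat"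
  shows "(\<Sum>A | card A = k. (subdet k (enum A) g X)\<^sup>2) =
         Determinant.det (Matrix.mat k k (\<lambda>(p, q). column (g p) X \<bullet> column (g q) X))"
proof -
  let ?P = "{p. p permutes {0..<k}}"
  have "(\<Sum>A | card A = k. (subdet k (enum A) g X)\<^sup>2) =
      (\<Sum>A | card A = k. \<Sum>p\<in>?P. (\<Prod>i = 0..<k. X $ (enum A \<circ> p) i $ g i) * subdet k (enum A \<circ> p) g X)"
    unfolding power2_eq_square
    by (intro sum.cong refl, subst (2) subdet_expand)
       (simp add: sum_distrib_left subdet_permute_rows mult_ac)
  also have "\<dots> = (\<Sum>f\<in>{0..<k} \<rightarrow>\<^sub>E UNIV. (\<Prod>i = 0..<k. X $ f i $ g i) * subdet k f g X)"
    by (rule sum_functions_by_image[symmetric]) (auto simp: subdet_eq_0_rows cong: subdet_cong)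
  also have "\<dots> = (\<Sum>f\<in>{0..<k} \<rightarrow>\<^sub>E UNIV. \<Sum>p\<in>?P. signof p * (\<Prod>i = 0..<k. X $ f i $ g i * X $ f i $ g (p i)))"
  proof (intro sum.cong refl)
    fix f :: "nat \<Rightarrow> 'm"
    have "subdet k f g X = (\<Sum>p\<in>?P. signof p * (\<Prod>i = 0..<k. X $ f i $ g (p i)))"
      unfolding subdet_def by (subst det_def'[where n = k]) (auto intro!: sum.cong prod.cong dest: permutes_in_image)
    then show "(\<Prod>i = 0..<k. X $ f i $ g i) * subdet k f g X =
        (\<Sum>p\<in>?P. signof p * (\<Prod>i = 0..<k. X $ f i $ g i * X $ f i $ g (p i)))"
      by (simp add: sum_distrib_left prod.distrib mult_ac)
  qed
  also have "\<dots> = (\<Sum>p\<in>?P. signof p * (\<Sum>f\<in>{0..<k} \<rightarrow>\<^sub>E UNIV. \<Prod>i = 0..<k. X $ f i $ g i * X $ f i $ g (p i)))"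
    by (subst sum.swap) (simp add: sum_distrib_left)
  also have "\<dots> = (\<Sum>p\<in>?P. signof p * (\<Prod>i = 0..<k. column (g i) X \<bullet> column (g (p i)) X))"
    by (intro sum.cong refl arg_cong2[of _ _ _ _ "(*)"], subst prod_sum_PiE[symmetric])
       (simp_all add: column_def inner_vec_def)
  also have "\<dots> = Determinant.det (Matrix.mat k k (\<lambda>(p, q). column (g p) X \<bullet> column (g q) X))"
    by (subst det_def'[where n = k]) (auto intro!: sum.cong prod.cong dest: permutes_in_image)
  finally show ?thesis .
qed

lemma Q_eq_subdet: "Q k X = (\<Sum>A | card A = k. \<Sum>B | card B = k. (subdet k (enum A) (enum B) X)\<^sup>2)"
  unfolding Q_def by (simp add: minor_eq_subdet)

lemma Q_eq_gram_columns:
  "Q k X = (\<Sum>B | card B = k. Determinant.det (Matrix.mat k k (\<lambda>(p, q). column (enum B p) X \<bullet> column (enum B q) X)))"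
  unfolding Q_eq_subdet by (subst sum.swap) (simp add: cauchy_binet_gram)

lemma Q_transpose: "Q k (Finite_Cartesian_Product.transpose X) = Q k X"
  unfolding Q_eq_subdet by (subst sum.swap) (simp add: subdet_transpose)

text \<open>\<open>Q k\<close> depends only on the inner products of the rows, and these are the entries of \<open>X\<close> times its transpose.\<close>

lemma Q_orthogonal_right:
  fixes X :: "('m::{finite,linorder}, 'n::{finite,linorder}) rmat"
  assumes "orthogonal_matrix R"
  shows "Q k (X ** R) = Q k X"
proof -
  let ?t = "Finite_Cartesian_Product.transpose"
  have gram: "column i (?t Y) \<bullet> column j (?t Y) = (Y ** ?t Y) $ i $ j" for i j and Y :: "('m, 'n) rmat"
    by (simp add: column_def inner_vec_def matrix_matrix_mult_def Finite_Cartesian_Product.transpose_def)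
  have "(X ** R) ** ?t (X ** R) = X ** ((R ** ?t R) ** ?t X)"
    by (simp only: matrix_transpose_mul matrix_mul_assoc)
  then have "(X ** R) ** ?t (X ** R) = X ** ?t X"
    using assms by (simp add: orthogonal_matrix_def)
  then have "Q k (?t (X ** R)) = Q k (?t X)"
    by (simp only: Q_eq_gram_columns gram)
  then show ?thesis by (simp add: Q_transpose)
qed

text \<open>For orthogonal columns the Gram matrices are diagonal.\<close>

lemma Q_orthogonal_columns:
  fixes Y :: "('m::{finite,linorder}, 'n::{finite,linorder}) rmat"
  assumes "\<And>a b. a \<noteq> b \<Longrightarrow> column a Y \<bullet> column b Y = 0"
  shows "Q k Y = (\<Sum>B | card B = k. \<Prod>b\<in>B. (norm (column b Y))\<^sup>2)"
  unfolding Q_eq_gram_columns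
proof (intro sum.cong refl)
  fix B :: "'n set" assume "B \<in> {B. card B = k}"
  then have e: "bij_betw (enum B) {0..<k} B" by (intro enum_bij) auto
  let ?G = "Matrix.mat k k (\<lambda>(p, q). column (enum B p) Y \<bullet> column (enum B q) Y)"
  have "Determinant.det ?G = prod_list (diag_mat ?G)"
  proof (rule det_upper_triangular)
    have "column (enum B p) Y \<bullet> column (enum B q) Y = 0" if "p < k" "q < k" "p \<noteq> q" for p q
      using e that by (intro assms) (auto simp: bij_betw_def inj_on_def)
    then show "upper_triangular ?G" by (auto simp: upper_triangular_def)
  qed auto
  also have "\<dots> = (\<Prod>p = 0..<k. (norm (column (enum B p) Y))\<^sup>2)"
  proof -
    have "prod_list (diag_mat ?G) = prod_list (map (\<lambda>p. (norm (column (enum B p) Y))\<^sup>2) [0..<k])"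
      by (intro arg_cong[of _ _ prod_list]) (auto simp: diag_mat_def power2_norm_eq_inner)
    also have "\<dots> = (\<Prod>p\<in>set [0..<k]. (norm (column (enum B p) Y))\<^sup>2)"
      by (rule prod.distinct_set_conv_list[symmetric]) simp
    finally show ?thesis by simp
  qed
  also have "\<dots> = (\<Prod>b\<in>B. (norm (column b Y))\<^sup>2)"
    by (rule prod.reindex_bij_betw[OF e])
  finally show "Determinant.det ?G = (\<Prod>b\<in>B. (norm (column b Y))\<^sup>2)" .
qed

lemma subdet_le_Q:
  fixes X :: "('m::{finite,linorder}, 'n::{finite,linorder}) rmat"
  shows "(subdet k f g X)\<^sup>2 \<le> Q k X"
proof (cases "inj_on f {0..<k} \<and> inj_on g {0..<k}")
  case True
  obtain A p where p: "card A = k" "p permutes {0..<k}" "\<And>i. i < k \<Longrightarrow> f i = enum A (p i)"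
    by (rule inj_on_enum_permute[OF conjunct1[OF True]]) blast
  obtain B q where q: "card B = k" "q permutes {0..<k}" "\<And>i. i < k \<Longrightarrow> g i = enum B (q i)"
    by (rule inj_on_enum_permute[OF conjunct2[OF True]]) blast
  have "subdet k f g X = subdet k (enum A \<circ> p) (enum B \<circ> q) X"
    using p(3) q(3) by (intro subdet_cong) auto
  also have "\<dots> = signof p * (signof q * subdet k (enum A) (enum B) X)"
    by (simp add: subdet_permute_rows[OF p(2)] subdet_permute_columns[OF q(2)])
  finally have "(subdet k f g X)\<^sup>2 = (subdet k (enum A) (enum B) X)\<^sup>2"
    by (simp add: power_mult_distrib sign_def)
  also have "\<dots> \<le> (\<Sum>B | card B = k. (subdet k (enum A) (enum B) X)\<^sup>2)"
    using q(1) by (intro member_le_sum) auto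
  also have "\<dots> \<le> Q k X"
    unfolding Q_eq_subdet using p(1)
    by (intro member_le_sum[of A _ "\<lambda>A. \<Sum>B | card B = k. (subdet k (enum A) (enum B) X)\<^sup>2"])
       (auto intro: sum_nonneg)
  finally show ?thesis .
next
  case False
  then have "subdet k f g X = 0"
    using subdet_eq_0_rows subdet_eq_0_columns by blast
  then show ?thesis by (auto simp: Q_def intro!: sum_nonneg)
qed

section \<open>Squared singular values\<close>

lemma column_matrix_mult: "column b (X ** R) = X *v column b R"
  by (simp add: Finite_Cartesian_Product.vec_eq_iff column_def matrix_matrix_mult_def matrix_vector_mult_def)

lemma compact_orthogonal_matrices: "compact {R :: real^'n^'n. orthogonal_matrix R}"
  unfolding compact_eq_bounded_closed
proof
  have "norm R \<le> real CARD('n)" if "orthogonal_matrix R" for R :: "real^'n^'n"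
  proof -
    have "norm R \<le> (\<Sum>i\<in>UNIV. norm (R $ i))"
      unfolding norm_vec_def by (rule L2_set_le_sum) simp
    also have "\<dots> = (\<Sum>i\<in>(UNIV::'n set). 1)"
      using that by (intro sum.cong refl) (simp add: orthogonal_matrix_orthonormal_rows Finite_Cartesian_Product.row_def)
    finally show ?thesis by simp
  qed
  then show "bounded {R :: real^'n^'n. orthogonal_matrix R}"
    by (auto simp: bounded_iff)
  have "{R :: real^'n^'n. orthogonal_matrix R} =
      {R. \<forall>i j. (\<Sum>k\<in>UNIV. R $ k $ i * R $ k $ j) = (if i = j then 1 else 0)}"
  proof -
    have eqs: "(Finite_Cartesian_Product.transpose R ** R) $ i $ j = (\<Sum>k\<in>UNIV. R $ k $ i * R $ k $ j)"
      and eqs': "(Finite_Cartesian_Product.mat 1 :: real^'n^'n) $ i $ j = (if i = j then 1 else 0)" for R :: "real^'n^'n" and i j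
      by (simp_all add: matrix_matrix_mult_def Finite_Cartesian_Product.transpose_def Finite_Cartesian_Product.mat_def)
    show ?thesis unfolding orthogonal_matrix Finite_Cartesian_Product.vec_eq_iff eqs eqs' by (rule refl)
  qed
  also have "closed \<dots>"
    by (intro closed_Collect_all closed_Collect_eq continuous_intros)
  finally show "closed {R :: real^'n^'n. orthogonal_matrix R}" .
qed

text \<open>This is the spectral theorem for the Gram matrix, by maximization: give the columns distinct weights \<open>d\<close> and
maximize the weighted sum of the squared lengths of the columns of \<open>X ** R\<close> over the compact set of orthogonal
matrices. Rotating two columns \<open>a\<close>, \<open>b\<close> of a maximizer into each other changes the sum to first order by
\<open>2 * (d a - d b)\<close> times the inner product of the columns \<open>a\<close> and \<open>b\<close> of \<open>X ** R\<close>, which therefore vanishes.\<close>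

lemma exists_orthogonalizing_matrix:
  fixes X :: "real^'n^'m"
  obtains R :: "real^'n^'n" where "orthogonal_matrix R"
    "\<And>a b. a \<noteq> b \<Longrightarrow> column a (X ** R) \<bullet> column b (X ** R) = 0"
proof -
  obtain d :: "'n \<Rightarrow> nat" where d: "inj d"
    using finite_imp_inj_to_nat_seg[of "UNIV :: 'n set"] by auto
  define F where "F R = (\<Sum>b\<in>UNIV. real (d b) * (norm (X *v column b R))\<^sup>2)" for R :: "real^'n^'n"
  have cont: "continuous_on S F" for S
    unfolding F_def column_def matrix_vector_mult_def by (intro continuous_intros)
  have "{R :: real^'n^'n. orthogonal_matrix R} \<noteq> {}"
    using orthogonal_matrix_id by blast
  from continuous_attains_sup[OF compact_orthogonal_matrices this cont]
  obtain R where R: "orthogonal_matrix R" "\<And>R'. orthogonal_matrix R' \<Longrightarrow> F R' \<le> F R"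
    by auto
  have "column a (X ** R) \<bullet> column b (X ** R) = 0" if "a \<noteq> b" for a b
  proof -
    let ?y = "\<lambda>c. X *v column c R"
    have onorm: "column c R \<bullet> column c R = 1" for c
      using R(1) by (simp add: orthogonal_matrix_orthonormal_columns norm_eq_1)
    have orth: "column c R \<bullet> column c' R = 0" if "c \<noteq> c'" for c c'
      using R(1) that by (simp add: orthogonal_matrix_orthonormal_columns real_inner_class.orthogonal_def)
    define r where "r t c = (if c = a then cos t *\<^sub>R column a R + sin t *\<^sub>R column b R
        else if c = b then cos t *\<^sub>R column b R - sin t *\<^sub>R column a R else column c R)" for t c
    define S where "S t = (\<chi> i c. r t c $ i)" for t
    have colS: "column c (S t) = r t c" for c t
      by (simp add: S_def column_def Finite_Cartesian_Product.vec_eq_iff)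
    have sc: "cos t * cos t + sin t * sin t = 1" for t :: real
      using sin_cos_squared_add2[of t] by (simp add: power2_eq_square)
    have "orthogonal_matrix (S t)" for t
      unfolding orthogonal_matrix_orthonormal_columns colS norm_eq_1 real_inner_class.orthogonal_def
      using \<open>a \<noteq> b\<close> sc[of t]
      by (auto simp: r_def onorm orth inner_simps algebra_simps)
    then have le: "F (S t) \<le> F R" for t
      by (rule R(2))
    define f where "f t = real (d a) * (norm (cos t *\<^sub>R ?y a + sin t *\<^sub>R ?y b))\<^sup>2 +
        real (d b) * (norm (cos t *\<^sub>R ?y b - sin t *\<^sub>R ?y a))\<^sup>2" for t
    have split: "(\<Sum>c\<in>UNIV. g c) = g a + g b + (\<Sum>c\<in>UNIV - {a, b}. g c)" for g :: "'n \<Rightarrow> real"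
      using \<open>a \<noteq> b\<close> by (subst sum.subset_diff[of "{a, b}"]) auto
    have FS: "F (S t) = f t + (\<Sum>c\<in>UNIV - {a, b}. real (d c) * (norm (?y c))\<^sup>2)" for t
      unfolding F_def colS using \<open>a \<noteq> b\<close>
      by (subst split) (auto simp: r_def f_def matrix_vector_right_distrib matrix_vector_mult_diff_distrib
           matrix_vector_mult_scaleR intro!: sum.cong)
    have FR: "F R = f 0 + (\<Sum>c\<in>UNIV - {a, b}. real (d c) * (norm (?y c))\<^sup>2)"
      unfolding F_def by (subst split) (simp add: f_def)
    have max: "f t \<le> f 0" for t
      using le[of t] by (simp add: FS FR)
    have "(f has_real_derivative 2 * (real (d a) - real (d b)) * (?y a \<bullet> ?y b)) (at 0)"
      unfolding f_def power2_norm_eq_inner inner_add_left inner_add_right inner_diff_left inner_diff_right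
        inner_scaleR_left inner_scaleR_right
      by (auto intro!: derivative_eq_intros simp: inner_commute algebra_simps)
    then have "2 * (real (d a) - real (d b)) * (?y a \<bullet> ?y b) = 0"
      by (rule DERIV_local_max[of _ _ _ 1]) (use max in auto)
    then show ?thesis
      using d \<open>a \<noteq> b\<close> by (auto simp: column_matrix_mult inj_eq)
  qed
  with R(1) show ?thesis by (rule that)
qed

lemma exists_decreasing_enumeration:
  fixes \<mu> :: "'n::finite \<Rightarrow> real"
  obtains e where "bij_betw e {..<CARD('n)} UNIV" "\<And>i j. i \<le> j \<Longrightarrow> j < CARD('n) \<Longrightarrow> \<mu> (e j) \<le> \<mu> (e i)"
proof -
  obtain xs :: "'n list" where xs: "set xs = UNIV" "distinct xs"
    using finite_distinct_list[of "UNIV :: 'n set"] by auto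
  define ys where "ys = sort_key (\<lambda>x. - \<mu> x) xs"
  have ys: "set ys = UNIV" "distinct ys" "sorted (map (\<lambda>x. - \<mu> x) ys)"
    using xs by (simp_all add: ys_def)
  have len: "length ys = CARD('n)"
    using distinct_card[OF ys(2)] ys(1) by simp
  have "bij_betw ((!) ys) {..<CARD('n)} UNIV"
    using bij_betw_nth[OF ys(2), of "{..<CARD('n)}" UNIV] ys(1) len by simp
  moreover have "\<mu> (ys ! j) \<le> \<mu> (ys ! i)" if "i \<le> j" "j < CARD('n)" for i j
    using sorted_nth_mono[OF ys(3), of i j] that len by simp
  ultimately show ?thesis by (rule that)
qed

text \<open>The factors that \<open>B\<close> and \<open>T\<close> do not share are equally many, and the largest one on the side of \<open>B\<close>
separates them.\<close>

lemma prod_le_prod_of_threshold: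
  fixes \<mu> :: "'a \<Rightarrow> real"
  assumes fin: "finite T" "finite B" and card: "card B = card T"
    and nonneg: "\<And>x. 0 \<le> \<mu> x" and thr: "\<And>x y. x \<in> T \<Longrightarrow> y \<notin> T \<Longrightarrow> \<mu> y \<le> \<mu> x"
  shows "prod \<mu> B \<le> prod \<mu> T"
proof (cases "B - T = {}")
  case True
  then have "B = T" using fin card card_subset_eq[of T B] by blast
  then show ?thesis by simp
next
  case False
  have eq: "card (B - T) = card (T - B)"
    using fin card by (metis add_left_cancel card_Diff_subset_Int card_Int_Diff finite_Int inf_commute)
  define v where "v = Max (\<mu> ` (B - T))"
  have v: "\<mu> y \<le> v" if "y \<in> B - T" for y
    using that fin by (simp add: v_def)
  have "v \<in> \<mu> ` (B - T)" unfolding v_def using False fin by (intro Max_in) auto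
  then have v': "v \<le> \<mu> x" if "x \<in> T - B" for x
    using that thr by auto
  have "0 \<le> v" using \<open>v \<in> \<mu> ` (B - T)\<close> nonneg by auto
  have "prod \<mu> (B - T) \<le> v ^ card (B - T)"
    using prod_mono[of "B - T" \<mu> "\<lambda>_. v"] nonneg v by simp
  also have "\<dots> \<le> prod \<mu> (T - B)"
    using prod_mono[of "T - B" "\<lambda>_. v" \<mu>] v' \<open>0 \<le> v\<close> eq by simp
  finally have "prod \<mu> (B \<inter> T) * prod \<mu> (B - T) \<le> prod \<mu> (B \<inter> T) * prod \<mu> (T - B)"
    by (intro mult_left_mono prod_nonneg) (auto simp: nonneg)
  also have "prod \<mu> (B \<inter> T) * prod \<mu> (B - T) = prod \<mu> B"
    using prod.Int_Diff[OF fin(2), of \<mu> T] by simp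
  also have "prod \<mu> (B \<inter> T) * prod \<mu> (T - B) = prod \<mu> T"
    using prod.Int_Diff[OF fin(1), of \<mu> B] by (simp add: Int_commute)
  finally show ?thesis .
qed

text \<open>An elementary symmetric function of nonnegative numbers is governed by its largest term.\<close>

lemma elementary_symmetric_bounds:
  fixes \<mu> :: "'n::finite \<Rightarrow> real"
  assumes nonneg: "\<And>x. 0 \<le> \<mu> x" and e: "bij_betw e {..<CARD('n)} UNIV"
    and dec: "\<And>i j. i \<le> j \<Longrightarrow> j < CARD('n) \<Longrightarrow> \<mu> (e j) \<le> \<mu> (e i)" and k: "k \<le> CARD('n)"
  shows "(\<Prod>i<k. \<mu> (e i)) \<le> (\<Sum>B | card B = k. prod \<mu> B)"
    and "(\<Sum>B | card B = k. prod \<mu> B) \<le> 2 ^ CARD('n) * (\<Prod>i<k. \<mu> (e i))"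
proof -
  define T where "T = e ` {..<k}"
  have inj: "inj_on e {..<CARD('n)}" using e by (simp add: bij_betw_def)
  then have injk: "inj_on e {..<k}" by (rule inj_on_subset) (use k in auto)
  have T: "card T = k" by (simp add: T_def card_image[OF injk])
  have P: "prod \<mu> T = (\<Prod>i<k. \<mu> (e i))"
    by (simp add: T_def prod.reindex[OF injk])
  have thr: "\<mu> y \<le> \<mu> x" if "x \<in> T" "y \<notin> T" for x y
  proof -
    obtain i where i: "x = e i" "i < k" using \<open>x \<in> T\<close> by (auto simp: T_def)
    have "y \<in> e ` {..<CARD('n)}" using e by (simp add: bij_betw_def)
    then obtain j where j: "y = e j" "j < CARD('n)" by auto
    have "\<not> j < k" using \<open>y \<notin> T\<close> j by (auto simp: T_def)
    then show ?thesis using dec[of i j] i j by simp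
  qed
  show "(\<Prod>i<k. \<mu> (e i)) \<le> (\<Sum>B | card B = k. prod \<mu> B)"
    unfolding P[symmetric] using T by (intro member_le_sum) (auto intro: prod_nonneg nonneg)
  have "(\<Sum>B | card B = k. prod \<mu> B) \<le> (\<Sum>B :: 'n set | card B = k. prod \<mu> T)"
    using T by (intro sum_mono prod_le_prod_of_threshold nonneg thr) auto
  also have "\<dots> = real (card {B :: 'n set. card B = k}) * prod \<mu> T" by simp
  also have "\<dots> \<le> 2 ^ CARD('n) * prod \<mu> T"
  proof (intro mult_right_mono prod_nonneg nonneg ballI)
    have "card {B :: 'n set. card B = k} \<le> card (UNIV :: 'n set set)"
      by (intro card_mono) auto
    then have "real (card {B :: 'n set. card B = k}) \<le> real (2 ^ CARD('n))"
      unfolding of_nat_le_iff by (simp add: card_UNIV_set)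
    then show "real (card {B :: 'n set. card B = k}) \<le> 2 ^ CARD('n)" by simp
  qed
  finally show "(\<Sum>B | card B = k. prod \<mu> B) \<le> 2 ^ CARD('n) * (\<Prod>i<k. \<mu> (e i))"
    by (simp add: P)
qed

text \<open>After division by powers of the common factor \<open>\<Prod>i<k - 1. l i\<close> and of \<open>\<Prod>i<s. l i\<close>, what remains is that
\<open>l (k - 1) ^ (k - s - 1)\<close> is at most the product of the \<open>k - s - 1\<close> numbers \<open>l i\<close> with \<open>s \<le> i < k - 1\<close>, each of which is at least
\<open>l (k - 1)\<close>.\<close>

lemma decreasing_prefix_products:
  fixes l :: "nat \<Rightarrow> real"
  assumes "\<And>i. 0 \<le> l i" and dec: "\<And>i j. i \<le> j \<Longrightarrow> j < k \<Longrightarrow> l j \<le> l i" and s: "s < k"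
  shows "(\<Prod>i<s. l i) * (\<Prod>i<k. l i) ^ (k - s - 1) \<le> (\<Prod>i<k - 1. l i) ^ (k - s)"
proof -
  let ?P = "\<lambda>j. \<Prod>i<j. l i"
  have P0: "0 \<le> ?P j" for j by (intro prod_nonneg) (auto simp: assms)
  have "l (k - 1) ^ (k - s - 1) = (\<Prod>i\<in>{s..<k - 1}. l (k - 1))"
    by simp
  also have "\<dots> \<le> (\<Prod>i\<in>{s..<k - 1}. l i)"
    using s by (intro prod_mono) (auto intro!: assms)
  finally have "?P s * l (k - 1) ^ (k - s - 1) \<le> ?P s * (\<Prod>i\<in>{s..<k - 1}. l i)"
    using P0 by (rule mult_left_mono)
  also have "\<dots> = ?P (k - 1)"
    using s prod.atLeastLessThan_concat[of 0 s "k - 1" l] by (simp add: lessThan_atLeast0)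
  finally have le: "?P s * l (k - 1) ^ (k - s - 1) \<le> ?P (k - 1)" .
  have "?P k = ?P (k - 1) * l (k - 1)"
    using s by (cases k) auto
  then have "?P s * ?P k ^ (k - s - 1) = ?P (k - 1) ^ (k - s - 1) * (?P s * l (k - 1) ^ (k - s - 1))"
    by (simp add: power_mult_distrib mult_ac)
  also have "\<dots> \<le> ?P (k - 1) ^ (k - s - 1) * ?P (k - 1)"
    using le P0 by (intro mult_left_mono) auto
  also have "\<dots> = ?P (k - 1) ^ Suc (k - s - 1)" by simp
  also have "Suc (k - s - 1) = k - s" using s by simp
  finally show ?thesis .
qed

text \<open>\<open>R\<close> consists of right singular vectors, the eigenvectors of the Gram matrix, and \<open>e\<close> lists them by decreasing
singular value. The left singular vectors, which a zero singular value leaves undetermined, do not occur: their part is played by the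
orthogonal columns of \<open>X ** R\<close>.\<close>

definition singular_frame :: "('m::finite, 'n::finite) rmat \<Rightarrow> real^'n^'n \<Rightarrow> (nat \<Rightarrow> 'n) \<Rightarrow> bool" where
  "singular_frame X R e \<longleftrightarrow> orthogonal_matrix R \<and>
     (\<forall>a b. a \<noteq> b \<longrightarrow> column a (X ** R) \<bullet> column b (X ** R) = 0) \<and>
     bij_betw e {..<CARD('n)} UNIV \<and>
     (\<forall>i j. i \<le> j \<longrightarrow> j < CARD('n) \<longrightarrow> (norm (column (e j) (X ** R)))\<^sup>2 \<le> (norm (column (e i) (X ** R)))\<^sup>2)"

lemma exists_singular_frame:
  obtains R e where "singular_frame X R e"
proof -
  obtain R where R: "orthogonal_matrix R" "\<And>a b. a \<noteq> b \<Longrightarrow> column a (X ** R) \<bullet> column b (X ** R) = 0"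
    by (rule exists_orthogonalizing_matrix[of X]) blast
  show ?thesis
    by (rule exists_decreasing_enumeration[of "\<lambda>b. (norm (column b (X ** R)))\<^sup>2"])
       (rule that[of R], auto simp: singular_frame_def R)
qed

abbreviation singular_sq :: "('m::finite, 'n::finite) rmat \<Rightarrow> real^'n^'n \<Rightarrow> (nat \<Rightarrow> 'n) \<Rightarrow> nat \<Rightarrow> real" where
  "singular_sq X R e i \<equiv> (norm (column (e i) (X ** R)))\<^sup>2"

lemma Q_eq_elementary_symmetric:
  fixes X :: "('m::{finite,linorder}, 'n::{finite,linorder}) rmat"
  assumes "singular_frame X R e"
  shows "Q k X = (\<Sum>B | card B = k. \<Prod>b\<in>B. (norm (column b (X ** R)))\<^sup>2)"
proof -
  have "Q k X = Q k (X ** R)"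
    using assms by (simp add: singular_frame_def Q_orthogonal_right)
  also have "\<dots> = (\<Sum>B | card B = k. \<Prod>b\<in>B. (norm (column b (X ** R)))\<^sup>2)"
    using assms by (intro Q_orthogonal_columns) (simp add: singular_frame_def)
  finally show ?thesis .
qed

lemma Q_bounds:
  fixes X :: "('m::{finite,linorder}, 'n::{finite,linorder}) rmat"
  assumes "singular_frame X R e" "k \<le> CARD('n)"
  shows "(\<Prod>i<k. singular_sq X R e i) \<le> Q k X" "Q k X \<le> 2 ^ CARD('n) * (\<Prod>i<k. singular_sq X R e i)"
  unfolding Q_eq_elementary_symmetric[OF assms(1)]
  by (rule elementary_symmetric_bounds; use assms in \<open>simp add: singular_frame_def\<close>)+

lemma Q_nonneg: "0 \<le> Q k X"
  by (auto simp: Q_def intro!: sum_nonneg)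

text \<open>This is how the rank enters: where \<open>Q s\<close> is bounded away from 0, it bounds a power of \<open>Q k\<close> by a power of \<open>Q (k - 1)\<close>, and the exponents
depend on \<open>k - s\<close>.\<close>

lemma Q_interpolation:
  fixes X :: "('m::{finite,linorder}, 'n::{finite,linorder}) rmat"
  assumes "s < k" "k \<le> CARD('n)"
  shows "Q s X * Q k X ^ (k - s - 1) \<le> 2 ^ (CARD('n) * (k - s)) * Q (k - 1) X ^ (k - s)"
proof -
  obtain R e where fr: "singular_frame X R e" by (rule exists_singular_frame)
  let ?P = "\<lambda>j. \<Prod>i<j. singular_sq X R e i" and ?N = "2 ^ CARD('n) :: real"
  have "Q s X * Q k X ^ (k - s - 1) \<le> (?N * ?P s) * (?N * ?P k) ^ (k - s - 1)"
    using assms Q_bounds(2)[OF fr] by (intro mult_mono power_mono) (auto simp: Q_nonneg intro!: prod_nonneg mult_nonneg_nonneg)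
  also have "\<dots> = ?N ^ (Suc (k - s - 1)) * (?P s * ?P k ^ (k - s - 1))"
    by (simp add: power_mult_distrib)
  also have "Suc (k - s - 1) = k - s" using assms by simp
  also have "?N ^ (k - s) * (?P s * ?P k ^ (k - s - 1)) \<le> ?N ^ (k - s) * ?P (k - 1) ^ (k - s)"
    using assms fr by (intro mult_left_mono decreasing_prefix_products) (auto simp: singular_frame_def)
  also have "\<dots> \<le> ?N ^ (k - s) * Q (k - 1) X ^ (k - s)"
    using assms Q_bounds(1)[OF fr, of "k - 1"] by (intro mult_left_mono power_mono) (auto intro!: prod_nonneg)
  finally show ?thesis by (simp add: power_mult)
qed

section \<open>A lower bound for the gradient\<close>

lemma matrix_eq_sum_axis: "(V :: ('m::finite, 'n::finite) rmat) = (\<Sum>i\<in>UNIV. \<Sum>j\<in>UNIV. V $ i $ j *\<^sub>R axis i (axis j 1))"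
proof -
  have "(\<Sum>i\<in>UNIV. \<Sum>j\<in>UNIV. V $ i $ j *\<^sub>R axis i (axis j 1)) $ a $ b = V $ a $ b" for a b
  proof -
    have "(\<Sum>i\<in>UNIV. \<Sum>j\<in>UNIV. V $ i $ j *\<^sub>R axis i (axis j 1)) $ a $ b
        = (\<Sum>i\<in>UNIV. \<Sum>j\<in>UNIV. if i = a then if j = b then V $ i $ j else 0 else 0)"
      by (simp add: axis_def if_distrib[of "\<lambda>v. v $ _"] cong: if_cong) (intro sum.cong refl, simp)
    also have "\<dots> = (\<Sum>i\<in>UNIV. if i = a then \<Sum>j\<in>UNIV. if j = b then V $ i $ j else 0 else 0)"
      by (intro sum.cong) auto
    finally show ?thesis by simp
  qed
  then show ?thesis by (simp add: Finite_Cartesian_Product.vec_eq_iff)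
qed

lemma has_derivative_grad:
  assumes "f differentiable (at X)"
  shows "(f has_derivative (\<lambda>V. grad f X \<bullet> V)) (at X)"
proof -
  obtain D where D: "(f has_derivative D) (at X)"
    using assms by (auto simp: differentiable_def)
  interpret D: bounded_linear D using D by (rule has_derivative_bounded_linear)
  have part: "partial_deriv i j f X = D (axis i (axis j 1))" for i j
  proof -
    have "((\<lambda>t. X + t *\<^sub>R axis i (axis j 1)) has_derivative (\<lambda>t. t *\<^sub>R axis i (axis j 1))) (at (0::real))"
      by (auto intro!: derivative_eq_intros)
    moreover have "(f has_derivative D) (at (X + 0 *\<^sub>R axis i (axis j 1)))" using D by simp
    ultimately have "((\<lambda>t. f (X + t *\<^sub>R axis i (axis j 1))) has_derivative (\<lambda>t. D (t *\<^sub>R axis i (axis j 1)))) (at (0::real))"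
      by (rule has_derivative_compose)
    then have "((\<lambda>t. f (X + t *\<^sub>R axis i (axis j 1))) has_field_derivative D (axis i (axis j 1))) (at 0)"
      by (simp add: has_field_derivative_def D.scaleR mult.commute[of _ "D _"] cong: if_cong)
    then show ?thesis unfolding partial_deriv_def by (rule DERIV_imp_deriv)
  qed
  have "D V = grad f X \<bullet> V" for V
  proof -
    have "D V = D (\<Sum>i\<in>UNIV. \<Sum>j\<in>UNIV. V $ i $ j *\<^sub>R axis i (axis j 1))"
      using matrix_eq_sum_axis[of V] by simp
    also have "\<dots> = grad f X \<bullet> V"
      by (simp add: D.sum D.scaleR grad_def part inner_vec_def mult.commute)
    finally show ?thesis .
  qed
  then have "D = (\<lambda>V. grad f X \<bullet> V)" by (rule ext)
  with D show ?thesis by simp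
qed

lemma directional_derivative_le_grad:
  assumes "f differentiable (at X)" "((\<lambda>t. f (X + t *\<^sub>R V)) has_real_derivative d) (at 0)"
  shows "\<bar>d\<bar> \<le> norm (grad f X) * norm V"
proof -
  have "((\<lambda>t. X + t *\<^sub>R V) has_derivative (\<lambda>t. t *\<^sub>R V)) (at (0::real))"
    by (auto intro!: derivative_eq_intros)
  moreover have "(f has_derivative (\<lambda>V. grad f X \<bullet> V)) (at (X + 0 *\<^sub>R V))"
    using has_derivative_grad[OF assms(1)] by simp
  ultimately have "((\<lambda>t. f (X + t *\<^sub>R V)) has_derivative (\<lambda>t. grad f X \<bullet> (t *\<^sub>R V))) (at (0::real))"
    by (rule has_derivative_compose)
  then have "((\<lambda>t. f (X + t *\<^sub>R V)) has_real_derivative (grad f X \<bullet> V)) (at 0)"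
    by (simp add: has_field_derivative_def mult.commute[of _ "_ \<bullet> _"])
  then have "d = grad f X \<bullet> V" using assms(2) by (metis DERIV_unique)
  then show ?thesis using Cauchy_Schwarz_ineq2 by metis
qed

lemma differentiable_prod_real:
  fixes f :: "'i \<Rightarrow> 'a::real_normed_vector \<Rightarrow> real"
  assumes "\<And>i. i \<in> I \<Longrightarrow> f i differentiable (at x within S)"
  shows "(\<lambda>x. \<Prod>i\<in>I. f i x) differentiable (at x within S)"
  using assms by (induction I rule: infinite_finite_induct) (auto intro!: differentiable_mult)

lemma differentiable_subdet:
  fixes X :: "('m::finite, 'n::finite) rmat"
  shows "subdet k f g differentiable (at X)"
proof -
  have "(\<lambda>X :: ('m, 'n) rmat. X $ i $ j) differentiable (at X)" for i j
    by (intro bounded_linear_imp_differentiable bounded_linear_compose[OF bounded_linear_vec_nth] bounded_linear_vec_nth)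
  then have "(\<lambda>X. \<Sum>p | p permutes {0..<k}. signof p * (\<Prod>i = 0..<k. X $ f (p i) $ g i)) differentiable (at X)"
    by (intro differentiable_sum ballI differentiable_mult differentiable_const differentiable_prod_real)
       (auto intro: finite_permutations)
  then show ?thesis by (simp add: subdet_expand[abs_def])
qed

lemma differentiable_Q: "Q k differentiable (at X)"
  unfolding Q_eq_subdet[abs_def]
  by (intro differentiable_sum ballI differentiable_power differentiable_subdet) auto

lemma norm_outer_product: "norm ((\<chi> i j. v $ i * w $ j) :: ('m::finite, 'n::finite) rmat) = norm v * norm w"
proof -
  have "norm ((\<chi> i j. v $ i * w $ j) :: ('m, 'n) rmat) = L2_set (\<lambda>i. \<bar>v $ i\<bar> * norm w) UNIV"
    unfolding norm_vec_def[where 'b = 'm]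
    by (intro L2_set_cong) (simp_all add: norm_vec_def abs_mult L2_set_right_distrib)
  also have "\<dots> = norm v * norm w"
    by (simp add: L2_set_left_distrib norm_vec_def)
  finally show ?thesis .
qed

text \<open>Let \<open>b\<close> be the column of \<open>X ** R\<close> with the \<open>k\<close>-th largest length. Stretching it by \<open>1 + t\<close> multiplies by
\<open>(1 + t)\<^sup>2\<close> those terms of the elementary symmetric function that contain \<open>b\<close>; one of them is the product of the \<open>k\<close> largest
squared lengths. So the derivative at 0 is at least twice this product, whereas the direction has only the length of
the column \<open>b\<close>. Choosing a larger singular value would lose here, a smaller one would miss the largest term.\<close>

lemma norm_grad_Q_ge_prefix_products:
  fixes X :: "('m::{finite,linorder}, 'n::{finite,linorder}) rmat"
  assumes fr: "singular_frame X R e" and k: "1 \<le> k" "k \<le> CARD('n)"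
  shows "4 * (\<Prod>i<k. singular_sq X R e i) * (\<Prod>i<k - 1. singular_sq X R e i) \<le> (norm (grad (Q k) X))\<^sup>2"
proof -
  let ?l = "singular_sq X R e" and ?y = "\<lambda>b. column b (X ** R)"
  define b where "b = e (k - 1)"
  have R: "orthogonal_matrix R" and ort: "a \<noteq> c \<Longrightarrow> ?y a \<bullet> ?y c = 0" for a c
    using fr by (auto simp: singular_frame_def)
  \<comment> \<open>The direction \<open>V\<close> stretches the column \<open>b\<close> of \<open>X ** R\<close> and fixes the others.\<close>
  define V where "V = (\<chi> i j. ?y b $ i * column b R $ j)"
  have normR: "norm (column b R) = 1"
    using R by (simp add: orthogonal_matrix_orthonormal_columns)
  have nV: "norm V = norm (?y b)"
    unfolding V_def by (simp only: norm_outer_product normR mult_1_right)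
  have VR: "column c (V ** R) = (if c = b then ?y b else 0)" for c
  proof -
    have "column c (V ** R) $ i = ?y b $ i * (column b R \<bullet> column c R)" for i
      by (simp add: V_def column_def[of _ "_ ** R"] matrix_matrix_mult_def inner_vec_def sum_distrib_left)
         (simp add: column_def mult_ac)
    moreover have "column b R \<bullet> column c R = (if c = b then 1 else 0)"
      using R normR by (auto simp: orthogonal_matrix_orthonormal_columns norm_eq_1 real_inner_class.orthogonal_def)
    ultimately show ?thesis by (simp add: Finite_Cartesian_Product.vec_eq_iff)
  qed
  have col: "column c ((X + t *\<^sub>R V) ** R) = (if c = b then 1 + t else 1) *\<^sub>R ?y c" for c t
  proof -
    have "column c ((X + t *\<^sub>R V) ** R) = ?y c + t *\<^sub>R column c (V ** R)"
      by (simp add: Finite_Cartesian_Product.vec_eq_iff column_def matrix_matrix_mult_def algebra_simps sum.distrib sum_distrib_left)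
    then show ?thesis by (simp add: VR algebra_simps)
  qed
  let ?\<mu> = "\<lambda>c. (norm (?y c))\<^sup>2"
  have "Q k (X + t *\<^sub>R V) = (\<Sum>B | card B = k. (if b \<in> B then (1 + t)\<^sup>2 else 1) * prod ?\<mu> B)" for t
  proof -
    have "Q k (X + t *\<^sub>R V) = Q k ((X + t *\<^sub>R V) ** R)"
      by (rule Q_orthogonal_right[OF R, symmetric])
    also have "\<dots> = (\<Sum>B | card B = k. \<Prod>c\<in>B. (norm (column c ((X + t *\<^sub>R V) ** R)))\<^sup>2)"
      by (intro Q_orthogonal_columns) (simp add: col ort)
    also have "\<dots> = (\<Sum>B | card B = k. (if b \<in> B then (1 + t)\<^sup>2 else 1) * prod ?\<mu> B)"
    proof (intro sum.cong refl)
      fix B :: "'n set"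
      have "(\<Prod>c\<in>B. (norm (column c ((X + t *\<^sub>R V) ** R)))\<^sup>2) = (\<Prod>c\<in>B. (if c = b then (1 + t)\<^sup>2 else 1) * ?\<mu> c)"
        by (intro prod.cong refl) (simp add: col power_mult_distrib)
      also have "\<dots> = (\<Prod>c\<in>B. if c = b then (1 + t)\<^sup>2 else 1) * prod ?\<mu> B"
        by (rule prod.distrib)
      also have "(\<Prod>c\<in>B. if c = b then (1 + t)\<^sup>2 else 1) = (if b \<in> B then (1 + t)\<^sup>2 else 1)"
        by (simp add: prod.delta)
      finally show "(\<Prod>c\<in>B. (norm (column c ((X + t *\<^sub>R V) ** R)))\<^sup>2) = (if b \<in> B then (1 + t)\<^sup>2 else 1) * prod ?\<mu> B" .
    qed
    finally show ?thesis .
  qed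
  moreover have "((\<lambda>t. \<Sum>B | card B = k. (if b \<in> B then (1 + t)\<^sup>2 else 1) * prod ?\<mu> B) has_real_derivative
      (\<Sum>B | card B = k. (if b \<in> B then 2 else 0) * prod ?\<mu> B)) (at 0)"
    by (intro DERIV_sum DERIV_cmult_right) (auto intro!: derivative_eq_intros)
  ultimately have "\<bar>\<Sum>B | card B = k. (if b \<in> B then 2 else 0) * prod ?\<mu> B\<bar> \<le> norm (grad (Q k) X) * norm V"
    by (intro directional_derivative_le_grad differentiable_Q) simp
  moreover have "2 * (\<Prod>i<k. ?l i) \<le> (\<Sum>B | card B = k. (if b \<in> B then 2 else 0) * prod ?\<mu> B)"
  proof -
    have inj: "inj_on e {..<k}"
      using fr k by (auto simp: singular_frame_def bij_betw_def intro: inj_on_subset)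
    have "2 * (\<Prod>i<k. ?l i) = (if b \<in> e ` {..<k} then 2 else 0) * prod ?\<mu> (e ` {..<k})"
      using k by (auto simp: b_def prod.reindex[OF inj])
    also have "\<dots> \<le> (\<Sum>B | card B = k. (if b \<in> B then 2 else 0) * prod ?\<mu> B)"
      using card_image[OF inj] by (intro member_le_sum) (auto intro!: prod_nonneg)
    finally show ?thesis .
  qed
  ultimately have le: "2 * (\<Prod>i<k. ?l i) \<le> norm (grad (Q k) X) * norm (?y b)"
    unfolding nV[symmetric] by linarith
  have P0: "0 \<le> (\<Prod>i<j. ?l i)" for j by (intro prod_nonneg) auto
  have Pk: "(\<Prod>i<k. ?l i) = (\<Prod>i<k - 1. ?l i) * (norm (?y b))\<^sup>2"
    using k by (cases k) (auto simp: b_def)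
  show ?thesis
  proof (cases "norm (?y b) = 0")
    case True
    then show ?thesis by (simp add: Pk)
  next
    case False
    have "(2 * (\<Prod>i<k. ?l i))\<^sup>2 \<le> (norm (grad (Q k) X) * norm (?y b))\<^sup>2"
      using le P0 by (intro power_mono) auto
    also have "(2 * (\<Prod>i<k. ?l i))\<^sup>2 = 4 * (\<Prod>i<k. ?l i) * (\<Prod>i<k. ?l i)"
      by (simp add: power2_eq_square)
    also have "\<dots> = 4 * (\<Prod>i<k. ?l i) * ((\<Prod>i<k - 1. ?l i) * (norm (?y b))\<^sup>2)"
      by (simp only: Pk[symmetric])
    finally have "4 * (\<Prod>i<k. ?l i) * (\<Prod>i<k - 1. ?l i) * (norm (?y b))\<^sup>2
        \<le> (norm (grad (Q k) X))\<^sup>2 * (norm (?y b))\<^sup>2"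
      by (simp add: power_mult_distrib mult.assoc)
    then show ?thesis using False by (simp add: mult_le_cancel_right)
  qed
qed

lemma norm_grad_Q_ge:
  fixes X :: "('m::{finite,linorder}, 'n::{finite,linorder}) rmat"
  assumes k: "1 \<le> k" "k \<le> CARD('n)"
  shows "Q (k - 1) X * Q k X \<le> 4 ^ CARD('n) * (norm (grad (Q k) X))\<^sup>2"
proof -
  obtain R e where fr: "singular_frame X R e" by (rule exists_singular_frame)
  let ?P = "\<lambda>j. \<Prod>i<j. singular_sq X R e i" and ?N = "2 ^ CARD('n) :: real"
  have P0: "0 \<le> ?P j" for j by (intro prod_nonneg) auto
  have "Q (k - 1) X * Q k X \<le> (?N * ?P (k - 1)) * (?N * ?P k)"
    using k Q_bounds(2)[OF fr] by (intro mult_mono) (auto simp: Q_nonneg P0)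
  also have "\<dots> = (?N * ?N) * (?P k * ?P (k - 1))"
    by (simp only: mult_ac)
  also have "?N * ?N = 4 ^ CARD('n)"
    by (simp flip: power_mult_distrib)
  also have "4 ^ CARD('n) * (?P k * ?P (k - 1)) \<le> 4 ^ CARD('n) * (norm (grad (Q k) X))\<^sup>2"
  proof (rule mult_left_mono)
    have "0 \<le> ?P k * ?P (k - 1)" by (intro mult_nonneg_nonneg P0)
    then show "?P k * ?P (k - 1) \<le> (norm (grad (Q k) X))\<^sup>2"
      using norm_grad_Q_ge_prefix_products[OF fr k] by (simp add: mult.assoc)
  qed simp
  finally show ?thesis .
qed

section \<open>An upper bound for the gradient\<close>

text \<open>The increasing enumeration of the natural numbers other than \<open>p\<close>.\<close>

abbreviation skip :: "nat \<Rightarrow> nat \<Rightarrow> nat" where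
  "skip p i \<equiv> if i < p then i else Suc i"

text \<open>The derivative of \<open>subdet k f g\<close> with respect to the entry at row \<open>i\<close> and column \<open>j\<close>, for injective \<open>f\<close>. The entry
may occur nowhere, or, as \<open>g\<close> is arbitrary, several times in one row; summing over all positions covers all cases.\<close>

definition cofactor_sum ::
    "nat \<Rightarrow> (nat \<Rightarrow> 'm::finite) \<Rightarrow> (nat \<Rightarrow> 'n::finite) \<Rightarrow> 'm \<Rightarrow> 'n \<Rightarrow> ('m, 'n) rmat \<Rightarrow> real" where
  "cofactor_sum k f g i j X = (\<Sum>p<k. \<Sum>q<k. if f p = i \<and> g q = j
     then (-1) ^ (p + q) * subdet (k - 1) (f \<circ> skip p) (g \<circ> skip q) X else 0)"

lemma subdet_laplace_row:
  assumes "p < k"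
  shows "subdet k f g X = (\<Sum>q<k. X $ f p $ g q * ((-1) ^ (p + q) * subdet (k - 1) (f \<circ> skip p) (g \<circ> skip q) X))"
proof -
  let ?A = "Matrix.mat k k (\<lambda>(p, q). X $ f p $ g q)"
  have "mat_delete ?A p q = Matrix.mat (k - 1) (k - 1) (\<lambda>(a, b). X $ (f \<circ> skip p) a $ (g \<circ> skip q) b)" if "q < k" for q
    using that assms unfolding mat_delete_def by (intro eq_matI) auto
  then show ?thesis
    using laplace_expansion_row[of ?A k p] assms
    by (simp add: subdet_def cofactor_def)
qed

text \<open>Laplace expansion along the only row that contains the entry at row \<open>i\<close> and column \<open>j\<close>: its cofactors do not involve this entry,
so that the determinant is an affine function of it.\<close>

lemma subdet_add_axis:
  assumes inj: "inj_on f {0..<k}"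
  shows "subdet k f g (X + t *\<^sub>R axis i (axis j 1)) = subdet k f g X + t * cofactor_sum k f g i j X"
proof (cases "\<exists>p<k. f p = i")
  case True
  then obtain p where p: "p < k" "f p = i" by auto
  let ?Y = "X + t *\<^sub>R axis i (axis j 1)"
  let ?c = "\<lambda>q. (-1) ^ (p + q) * subdet (k - 1) (f \<circ> skip p) (g \<circ> skip q) X"
  have other: "f (skip p a) \<noteq> i" if "a < k - 1" for a
  proof
    assume "f (skip p a) = i"
    then have "skip p a = p" using inj p that by (intro inj_onD[OF inj]) auto
    then show False by (simp split: if_splits)
  qed
  have eqc: "subdet (k - 1) (f \<circ> skip p) g' ?Y = subdet (k - 1) (f \<circ> skip p) g' X" for g'
    unfolding subdet_def using other
    by (intro arg_cong[of _ _ Determinant.det] eq_matI) (auto simp: axis_def)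
  have "subdet k f g ?Y = (\<Sum>q<k. ?Y $ i $ g q * ?c q)"
    using subdet_laplace_row[OF p(1), of f g ?Y] unfolding eqc p(2) .
  also have "\<dots> = (\<Sum>q<k. X $ i $ g q * ?c q + t * (if g q = j then ?c q else 0))"
    by (intro sum.cong refl) (simp add: axis_def algebra_simps)
  also have "\<dots> = subdet k f g X + t * (\<Sum>q<k. if g q = j then ?c q else 0)"
    using subdet_laplace_row[OF p(1), of f g X] unfolding p(2) by (simp add: sum.distrib sum_distrib_left)
  also have "(\<Sum>q<k. if g q = j then ?c q else 0) = cofactor_sum k f g i j X"
  proof -
    have eq: "f p' = i \<longleftrightarrow> p' = p" if "p' < k" for p'
      using inj p that by (auto simp: inj_on_def)
    have "cofactor_sum k f g i j X = (\<Sum>p'<k. if p' = p then \<Sum>q<k. if g q = j then ?c q else 0 else 0)"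
      unfolding cofactor_sum_def by (intro sum.cong refl) (auto simp: eq)
    then show ?thesis using p(1) by simp
  qed
  finally show ?thesis .
next
  case False
  then have "f p \<noteq> i" if "p < k" for p using that by auto
  then have "subdet k f g (X + t *\<^sub>R axis i (axis j 1)) = subdet k f g X" "cofactor_sum k f g i j X = 0"
    unfolding subdet_def cofactor_sum_def
    by (auto intro!: arg_cong[of _ _ Determinant.det] eq_matI simp: axis_def)
  then show ?thesis by simp
qed

lemma partial_deriv_Q:
  fixes X :: "('m::{finite,linorder}, 'n::{finite,linorder}) rmat"
  shows "partial_deriv i j (Q k) X = (\<Sum>A | card A = k. \<Sum>B | card B = k.
     2 * subdet k (enum A) (enum B) X * cofactor_sum k (enum A) (enum B) i j X)"
proof -
  have "Q k (X + t *\<^sub>R axis i (axis j 1)) = (\<Sum>A | card A = k. \<Sum>B | card B = k.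
      (subdet k (enum A) (enum B) X + t * cofactor_sum k (enum A) (enum B) i j X)\<^sup>2)" for t
    unfolding Q_eq_subdet
  proof (intro sum.cong refl)
    fix A :: "'m set" and B :: "'n set" assume "A \<in> {A. card A = k}"
    then have "inj_on (enum A) {0..<k}" using enum_bij[of A k] by (auto simp: bij_betw_def)
    then show "(subdet k (enum A) (enum B) (X + t *\<^sub>R axis i (axis j 1)))\<^sup>2 =
        (subdet k (enum A) (enum B) X + t * cofactor_sum k (enum A) (enum B) i j X)\<^sup>2"
      by (simp add: subdet_add_axis)
  qed
  moreover have "((\<lambda>t. \<Sum>A | card A = k. \<Sum>B | card B = k.
        (subdet k (enum A) (enum B) X + t * cofactor_sum k (enum A) (enum B) i j X)\<^sup>2) has_real_derivative
      (\<Sum>A | card A = k. \<Sum>B | card B = k.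
        2 * subdet k (enum A) (enum B) X * cofactor_sum k (enum A) (enum B) i j X)) (at 0)"
    by (intro DERIV_sum) (auto intro!: derivative_eq_intros)
  ultimately show ?thesis
    unfolding partial_deriv_def by (intro DERIV_imp_deriv) simp
qed

lemma real_analytic_at_subdet: "real_analytic_at (subdet k f g) X0"
  unfolding subdet_expand[abs_def]
  by (intro real_analytic_at_sum real_analytic_at_mult real_analytic_at_prod
      real_analytic_at_const real_analytic_at_entry)

lemma real_analytic_at_partial_deriv_Q: "real_analytic_at (partial_deriv i j (Q k)) X0"
proof -
  have ite: "real_analytic_at (\<lambda>X. if b then f X else 0) X0" if "real_analytic_at f X0" for b f
    using that by (cases b) (auto intro: real_analytic_at_const)
  show ?thesis
    unfolding partial_deriv_Q[abs_def] cofactor_sum_def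
    by (intro real_analytic_at_sum real_analytic_at_mult real_analytic_at_const real_analytic_at_subdet ite)
qed

lemma abs_cofactor_sum_le:
  fixes X :: "('m::{finite,linorder}, 'n::{finite,linorder}) rmat"
  shows "\<bar>cofactor_sum k f g i j X\<bar> \<le> real (k * k) * sqrt (Q (k - 1) X)"
proof -
  have "\<bar>cofactor_sum k f g i j X\<bar> \<le> (\<Sum>p<k. \<Sum>q<k. sqrt (Q (k - 1) X))"
    unfolding cofactor_sum_def
    by (intro order_trans[OF sum_abs] sum_mono)
       (auto simp: abs_mult power_abs Q_nonneg intro!: real_le_rsqrt subdet_le_Q)
  then show ?thesis by simp
qed

text \<open>By the product rule, a partial derivative of \<open>Q k\<close> is a sum of products of a \<open>k\<close>-minor with \<open>(k - 1)\<close>-minors, and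
each minor is at most the square root of the \<open>Q\<close> of its size.\<close>

lemma partial_deriv_Q_le:
  obtains C where "0 < C" "\<And>i j (X :: ('m::{finite,linorder}, 'n::{finite,linorder}) rmat). (partial_deriv i j (Q k) X)\<^sup>2 \<le> C * (Q (k - 1) X * Q k X)"
proof -
  define M where "M = real (card {A :: 'm set. card A = k}) * (real (card {B :: 'n set. card B = k}) * (2 * real (k * k))) + 1"
  have M: "0 < M" unfolding M_def by (intro add_nonneg_pos) auto
  have "(partial_deriv i j (Q k) X)\<^sup>2 \<le> M\<^sup>2 * (Q (k - 1) X * Q k X)" for i j and X :: "('m, 'n) rmat"
  proof -
    let ?S = "sqrt (Q k X) * sqrt (Q (k - 1) X)"
    have "\<bar>partial_deriv i j (Q k) X\<bar> \<le> (\<Sum>A :: 'm set | card A = k. \<Sum>B :: 'n set | card B = k. 2 * sqrt (Q k X) * (real (k * k) * sqrt (Q (k - 1) X)))"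
      unfolding partial_deriv_Q
    proof (intro order_trans[OF sum_abs] sum_mono)
      fix A :: "'m set" and B :: "'n set"
      have "\<bar>2 * subdet k (enum A) (enum B) X\<bar> \<le> 2 * sqrt (Q k X)"
        using real_le_rsqrt[of "\<bar>subdet k (enum A) (enum B) X\<bar>" "Q k X"] subdet_le_Q[of k "enum A" "enum B" X] by simp
      then show "\<bar>2 * subdet k (enum A) (enum B) X * cofactor_sum k (enum A) (enum B) i j X\<bar> \<le> 2 * sqrt (Q k X) * (real (k * k) * sqrt (Q (k - 1) X))"
        unfolding abs_mult[of "2 * _"] by (intro mult_mono abs_cofactor_sum_le) (auto simp: Q_nonneg)
    qed
    also have "\<dots> = (M - 1) * ?S" by (simp add: M_def mult_ac)
    also have "\<dots> \<le> M * ?S" by (intro mult_right_mono) (auto simp: Q_nonneg)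
    finally have "\<bar>partial_deriv i j (Q k) X\<bar>\<^sup>2 \<le> (M * ?S)\<^sup>2" by (intro power_mono) auto
    then show ?thesis by (simp add: power_mult_distrib Q_nonneg mult_ac)
  qed
  with M show ?thesis by (intro that[of "M\<^sup>2"]) auto
qed

lemma norm_grad_power2: "(norm (grad f X))\<^sup>2 = (\<Sum>i\<in>UNIV. \<Sum>j\<in>UNIV. (partial_deriv i j f X)\<^sup>2)"
  unfolding power2_norm_eq_inner inner_vec_def by (simp add: grad_def power2_eq_square)

lemma norm_grad_Q_le:
  obtains C where "0 < C" "\<And>X :: ('m::{finite,linorder}, 'n::{finite,linorder}) rmat.
    (norm (grad (Q k) X))\<^sup>2 \<le> C * (Q (k - 1) X * Q k X)"
proof -
  obtain C where C: "0 < C" "\<And>i j (X :: ('m, 'n) rmat). (partial_deriv i j (Q k) X)\<^sup>2 \<le> C * (Q (k - 1) X * Q k X)"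
    using partial_deriv_Q_le by blast
  have "(norm (grad (Q k) X))\<^sup>2 \<le> (\<Sum>i\<in>(UNIV :: 'm set). \<Sum>j\<in>(UNIV :: 'n set). C * (Q (k - 1) X * Q k X))" for X :: "('m, 'n) rmat"
    unfolding norm_grad_power2 by (intro sum_mono C)
  then show ?thesis
    using C(1) by (intro that[of "real CARD('m) * real CARD('n) * C"]) (auto simp: mult_ac)
qed

section \<open>The exponent at a matrix of given rank\<close>

lemma columns_eq_range: "columns X = range (\<lambda>b. column b X)"
  by (auto simp: columns_def)

lemma rank_orthogonal_columns:
  fixes Y :: "('m::finite, 'n::finite) rmat"
  assumes "\<And>a b. a \<noteq> b \<Longrightarrow> column a Y \<bullet> column b Y = 0"
  shows "rank Y = card {b. column b Y \<noteq> 0}"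
proof -
  let ?y = "\<lambda>b. column b Y" and ?N = "{b. column b Y \<noteq> 0}"
  have inj: "inj_on ?y ?N"
    using assms by (auto simp: inj_on_def) (metis inner_eq_zero_iff)
  have "independent (?y ` ?N)"
    by (rule pairwise_orthogonal_independent)
       (auto simp: pairwise_def real_inner_class.orthogonal_def intro!: assms)
  moreover have "span (columns Y) = span (?y ` ?N)"
  proof -
    have "columns Y - {0} = ?y ` ?N" by (auto simp: columns_eq_range)
    then show ?thesis by (metis span_delete_0)
  qed
  ultimately have "dim (columns Y) = card (?y ` ?N)"
    by (metis dim_span_eq_card_independent dim_span)
  then show ?thesis
    by (simp add: column_rank_def card_image[OF inj])
qed

lemma rank_orthogonal_right:
  fixes X :: "('m::finite, 'n::finite) rmat"
  assumes "orthogonal_matrix R"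
  shows "rank (X ** R) = rank X"
proof (rule antisym)
  show "rank (X ** R) \<le> rank X" by (rule rank_mul_le_left)
  have "(X ** R) ** Finite_Cartesian_Product.transpose R = X"
    using assms by (simp add: orthogonal_matrix_def flip: matrix_mul_assoc)
  then show "rank X \<le> rank (X ** R)" using rank_mul_le_left[of "X ** R" "Finite_Cartesian_Product.transpose R"] by simp
qed

text \<open>The rank is the number of nonzero columns of \<open>X ** R\<close>, and the zero ones are listed last.\<close>

lemma frame_column_nonzero_iff:
  fixes X :: "('m::finite, 'n::finite) rmat"
  assumes fr: "singular_frame X R e" and i: "i < CARD('n)"
  shows "column (e i) (X ** R) \<noteq> 0 \<longleftrightarrow> i < rank X"
proof -
  let ?I = "{i. i < CARD('n) \<and> column (e i) (X ** R) \<noteq> 0}"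
  have e: "bij_betw e {..<CARD('n)} UNIV" using fr by (simp add: singular_frame_def)
  have "rank X = card {b. column b (X ** R) \<noteq> 0}"
    using fr rank_orthogonal_columns[of "X ** R"] by (simp add: singular_frame_def rank_orthogonal_right)
  also have "{b. column b (X ** R) \<noteq> 0} = e ` ?I"
  proof (intro equalityI subsetI)
    fix b assume b: "b \<in> {b. column b (X ** R) \<noteq> 0}"
    obtain j where "j < CARD('n)" "b = e j"
      using bij_betw_imp_surj_on[OF e] by (metis UNIV_I imageE lessThan_iff)
    with b show "b \<in> e ` ?I" by auto
  qed auto
  also have "card (e ` ?I) = card ?I"
    using e by (intro card_image) (auto simp: bij_betw_def inj_on_def)
  finally have r: "rank X = card ?I" .
  have down: "j \<in> ?I" if "i \<in> ?I" "j \<le> i" for i j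
  proof -
    have "(norm (column (e i) (X ** R)))\<^sup>2 \<le> (norm (column (e j) (X ** R)))\<^sup>2"
      using fr that by (auto simp: singular_frame_def)
    moreover have "0 < (norm (column (e i) (X ** R)))\<^sup>2" using that by simp
    ultimately have "0 < (norm (column (e j) (X ** R)))\<^sup>2" by linarith
    then show ?thesis using that by auto
  qed
  have fin: "finite ?I" by simp
  show ?thesis
  proof
    assume "column (e i) (X ** R) \<noteq> 0"
    then have "{..i} \<subseteq> ?I" using i down by blast
    from card_mono[OF fin this] show "i < rank X" by (simp add: r)
  next
    assume "i < rank X"
    show "column (e i) (X ** R) \<noteq> 0"
    proof
      assume "column (e i) (X ** R) = 0"
      then have "?I \<subseteq> {..<i}" using down by (metis (mono_tags, lifting) lessThan_iff linorder_not_less mem_Collect_eq subsetI)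
      from card_mono[OF _ this] \<open>i < rank X\<close> show False by (simp add: r)
    qed
  qed
qed

lemma Q_pos_iff:
  fixes X :: "('m::{finite,linorder}, 'n::{finite,linorder}) rmat"
  assumes "k \<le> CARD('n)"
  shows "0 < Q k X \<longleftrightarrow> k \<le> rank X"
proof -
  obtain R e where fr: "singular_frame X R e" by (rule exists_singular_frame)
  let ?P = "\<Prod>i<k. singular_sq X R e i"
  have "0 < ?P \<longleftrightarrow> (\<forall>i<k. column (e i) (X ** R) \<noteq> 0)"
    unfolding less_le[of 0 ?P] by (simp add: prod_nonneg Ball_def)
  also have "\<dots> \<longleftrightarrow> (\<forall>i<k. i < rank X)"
    using assms frame_column_nonzero_iff[OF fr] by auto
  also have "\<dots> \<longleftrightarrow> k \<le> rank X" by (metis linorder_not_less order_refl dual_order.strict_trans1)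
  finally have "0 < ?P \<longleftrightarrow> k \<le> rank X" .
  moreover have "0 < Q k X \<longleftrightarrow> 0 < ?P"
  proof
    assume "0 < Q k X"
    then have "0 < 2 ^ CARD('n) * ?P" using Q_bounds(2)[OF fr assms] by linarith
    then show "0 < ?P" by (simp add: zero_less_mult_iff)
  qed (use Q_bounds(1)[OF fr assms] in linarith)
  ultimately show ?thesis by simp
qed

text \<open>With \<open>p = k - s\<close>: near \<open>X0\<close>, \<open>Q (k - 1)\<close> is at least a constant times \<open>(Q k) powr (1 - 1 / p)\<close> by
\<open>Q_interpolation\<close>, hence the squared norm of the gradient is at least a constant times \<open>(Q k) powr (2 - 1 / p)\<close>.\<close>

lemma lojasiewicz_exponent_attained:
  fixes X0 :: "('m::{finite,linorder}, 'n::{finite,linorder}) rmat"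
  assumes s: "rank X0 = s" "s < k" and k: "k \<le> CARD('n)"
  shows "1 - 1 / (2 * (real k - real s)) \<in> lojasiewicz_exponents (Q k) X0"
proof -
  define p where "p = k - s"
  have p: "1 \<le> p" "real k - real s = real p" using s by (auto simp: p_def of_nat_diff)
  define \<theta> where "\<theta> = 1 - 1 / (2 * real p)"
  have \<theta>: "1 / 2 \<le> \<theta>" "\<theta> < 1" using p by (auto simp: \<theta>_def field_simps)
  have Q0: "Q k X0 = 0"
    using Q_pos_iff[OF k, of X0] Q_nonneg[of k X0] s by auto
  define c0 where "c0 = Q s X0 / 2"
  have c0: "0 < c0" using Q_pos_iff[of s X0] s k by (simp add: c0_def)
  have "isCont (Q s) X0"
    by (intro differentiable_imp_continuous_within differentiable_Q)
  then have "(Q s \<longlongrightarrow> Q s X0) (nhds X0)"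
    unfolding isCont_def by (metis tendsto_at_iff_tendsto_nhds)
  then have ev: "\<forall>\<^sub>F X in nhds X0. c0 < Q s X"
    using c0 by (intro order_tendstoD) (auto simp: c0_def)
  define K where "K = (2::real) ^ (CARD('n) * p)"
  define M where "M = (4::real) ^ CARD('n)"
  have KM: "0 < K" "0 < M" by (auto simp: K_def M_def)
  define c1 where "c1 = (c0 / K) powr (1 / real p)"
  have c1: "0 < c1" using c0 KM by (simp add: c1_def)
  have "sqrt (c1 / M) * \<bar>Q k X - Q k X0\<bar> powr \<theta> \<le> norm (grad (Q k) X)" if X: "c0 < Q s X" for X :: "('m, 'n) rmat"
  proof (cases "Q k X = 0")
    case False
    then have q: "0 < Q k X" using Q_nonneg[of k X] by simp
    have "c0 * Q k X ^ (p - 1) \<le> Q s X * Q k X ^ (p - 1)"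
      using X by (intro mult_right_mono) (auto simp: Q_nonneg)
    also have "\<dots> \<le> K * Q (k - 1) X ^ p"
      using Q_interpolation[OF s(2) k, of X] by (simp add: p_def K_def)
    finally have le: "c0 / K * Q k X ^ (p - 1) \<le> Q (k - 1) X ^ p"
      using KM by (simp add: field_simps)
    have "Q k X ^ (p - 1) = Q k X powr (real p - 1)"
      using q p(1) by (simp add: of_nat_diff flip: powr_realpow)
    moreover have "(real p - 1) * (1 / real p) = 1 - 1 / real p"
      using p(1) by (simp add: field_simps)
    ultimately have "c1 * Q k X powr (1 - 1 / real p) = (c0 / K * Q k X ^ (p - 1)) powr (1 / real p)"
      using q c0 KM by (simp only: c1_def powr_mult[of "c0 / K"] powr_powr)
    also have "\<dots> \<le> (Q (k - 1) X ^ p) powr (1 / real p)"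
      using le c0 KM by (intro powr_mono2) (auto simp: Q_nonneg)
    also have "\<dots> = Q (k - 1) X"
      using p Q_nonneg[of "k - 1" X] by (cases "Q (k - 1) X = 0") (auto simp: powr_powr simp flip: powr_realpow)
    finally have u: "c1 * Q k X powr (1 - 1 / real p) \<le> Q (k - 1) X" .
    have "(sqrt (c1 / M) * Q k X powr \<theta>)\<^sup>2 = c1 / M * (Q k X powr (1 + (1 - 1 / real p)))"
    proof -
      have "(Q k X powr \<theta>)\<^sup>2 = Q k X powr (\<theta> + \<theta>)"
        by (simp only: power2_eq_square powr_add)
      also have "\<theta> + \<theta> = 1 + (1 - 1 / real p)" using p(1) by (simp add: \<theta>_def field_simps)
      finally show ?thesis using c1 KM by (simp add: power_mult_distrib)
    qed
    also have "Q k X powr (1 + (1 - 1 / real p)) = Q k X * Q k X powr (1 - 1 / real p)"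
      using q by (subst powr_add) simp
    also have "c1 / M * (Q k X * Q k X powr (1 - 1 / real p)) = (c1 * Q k X powr (1 - 1 / real p)) * Q k X / M"
      by simp
    also have "\<dots> \<le> Q (k - 1) X * Q k X / M"
      using u q KM by (intro divide_right_mono mult_right_mono) auto
    also have "\<dots> \<le> (norm (grad (Q k) X))\<^sup>2"
      using norm_grad_Q_ge[of k X] k s KM by (simp add: M_def field_simps)
    finally have "sqrt (c1 / M) * Q k X powr \<theta> \<le> norm (grad (Q k) X)"
      by (rule power2_le_imp_le) simp
    then show ?thesis using q by (simp add: Q0)
  qed (simp add: Q0)
  then have "\<forall>\<^sub>F X in nhds X0. sqrt (c1 / M) * \<bar>Q k X - Q k X0\<bar> powr \<theta> \<le> norm (grad (Q k) X)"
    using ev by (auto elim: eventually_mono)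
  then show ?thesis
    unfolding lojasiewicz_exponents_def p(2) using \<theta> c1 KM
    by (auto simp: \<theta>_def intro!: exI[of _ "sqrt (c1 / M)"])
qed


lemma exists_orthonormal_complement:
  fixes S :: "'a::euclidean_space set"
  assumes "p + dim S \<le> DIM('a)"
  obtains u :: "nat \<Rightarrow> 'a" where "\<And>i. i < p \<Longrightarrow> norm (u i) = 1"
    "\<And>i j. i < p \<Longrightarrow> j < p \<Longrightarrow> i \<noteq> j \<Longrightarrow> u i \<bullet> u j = 0"
    "\<And>i x. i < p \<Longrightarrow> x \<in> S \<Longrightarrow> x \<bullet> u i = 0"
proof -
  define T where "T = {y. \<forall>x\<in>span S. real_inner_class.orthogonal x y}"
  have dimT: "dim T + dim S = DIM('a)"
    using dim_subspace_orthogonal_to_vectors[of "span S" UNIV] by (simp add: T_def)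
  have "subspace T" unfolding T_def by (rule subspace_orthogonal_to_vectors)
  then obtain B where B: "B \<subseteq> T" "pairwise real_inner_class.orthogonal B" "\<And>x. x \<in> B \<Longrightarrow> norm x = 1"
      "independent B" "card B = dim T" "span B = T"
    by (rule orthonormal_basis_subspace) blast
  have fin: "finite B" using B(4) by (rule independent_imp_finite)
  obtain u where u: "bij_betw u {0..<card B} B"
    using ex_bij_betw_nat_finite[OF fin] by blast
  have mem: "u i \<in> B" if "i < p" for i
    using u that assms dimT B(5) by (auto simp: bij_betw_def)
  have "u i \<bullet> u j = 0" if "i < p" "j < p" "i \<noteq> j" for i j
  proof -
    have "u i \<noteq> u j" using u that assms dimT B(5) by (auto simp: bij_betw_def inj_on_def)
    then show ?thesis using B(2) mem that by (auto simp: pairwise_def real_inner_class.orthogonal_def)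
  qed
  moreover have "x \<bullet> u i = 0" if "i < p" "x \<in> S" for i x
    using mem[OF that(1)] B(1) span_base[OF that(2)] by (auto simp: T_def real_inner_class.orthogonal_def)
  ultimately show ?thesis using B(3) mem by (intro that[of u]) auto
qed

text \<open>Scaling by \<open>t\<close> the columns outside \<open>E\<close>: a set \<open>B\<close> of \<open>j\<close> columns meets the complement of \<open>E\<close> in at least \<open>j - s\<close>
elements, and in exactly that many if it contains \<open>E\<close>.\<close>

lemma Q_column_scaling_bounds:
  fixes Y :: "real \<Rightarrow> ('m::{finite,linorder}, 'n::{finite,linorder}) rmat"
  assumes ort: "\<And>t a b. a \<noteq> b \<Longrightarrow> column a (Y t) \<bullet> column b (Y t) = 0"
    and norm: "\<And>t b. norm (column b (Y t)) = (if b \<in> E then 1 else \<bar>t\<bar>) * \<nu> b"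
    and t: "\<bar>t\<bar> \<le> 1" and E: "card E = s"
  shows "Q j (Y t) \<le> (\<Sum>B | card B = j. \<Prod>b\<in>B. (\<nu> b)\<^sup>2) * t ^ (2 * (j - s))"
    and "card B = j \<Longrightarrow> E \<subseteq> B \<Longrightarrow> (\<Prod>b\<in>B. (\<nu> b)\<^sup>2) * t ^ (2 * (j - s)) \<le> Q j (Y t)"
proof -
  have prod: "(\<Prod>b\<in>B. (norm (column b (Y t)))\<^sup>2) = (\<Prod>b\<in>B. (\<nu> b)\<^sup>2) * (t\<^sup>2) ^ card (B - E)" for B
  proof -
    have "(\<Prod>b\<in>B. (norm (column b (Y t)))\<^sup>2) = (\<Prod>b\<in>B. (\<nu> b)\<^sup>2) * (\<Prod>b\<in>B. if b \<in> E then 1 else t\<^sup>2)"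
      unfolding prod.distrib[symmetric] by (intro prod.cong) (auto simp: norm power_mult_distrib)
    also have "(\<Prod>b\<in>B. if b \<in> E then 1 else t\<^sup>2) = (\<Prod>b\<in>B - E. t\<^sup>2)"
      by (intro prod.mono_neutral_cong_right) auto
    finally show ?thesis by simp
  qed
  have Q: "Q j (Y t) = (\<Sum>B | card B = j. (\<Prod>b\<in>B. (\<nu> b)\<^sup>2) * (t\<^sup>2) ^ card (B - E))"
    by (subst Q_orthogonal_columns) (simp_all add: ort prod)
  have "(\<Prod>b\<in>B. (\<nu> b)\<^sup>2) * (t\<^sup>2) ^ card (B - E) \<le> (\<Prod>b\<in>B. (\<nu> b)\<^sup>2) * t ^ (2 * (j - s))" if "card B = j" for B
  proof -
    have "j - s \<le> card (B - E)" using diff_card_le_card_Diff[of E B] that E by simp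
    moreover have "t\<^sup>2 \<le> 1" using t by (simp add: abs_square_le_1)
    ultimately have "(t\<^sup>2) ^ card (B - E) \<le> (t\<^sup>2) ^ (j - s)" by (intro power_decreasing) auto
    then show ?thesis by (intro mult_left_mono prod_nonneg) (auto simp: power_mult)
  qed
  then show "Q j (Y t) \<le> (\<Sum>B | card B = j. \<Prod>b\<in>B. (\<nu> b)\<^sup>2) * t ^ (2 * (j - s))"
    unfolding Q sum_distrib_right by (intro sum_mono) auto
  show "(\<Prod>b\<in>B. (\<nu> b)\<^sup>2) * t ^ (2 * (j - s)) \<le> Q j (Y t)" if B: "card B = j" "E \<subseteq> B"
  proof -
    have "card (B - E) = j - s" using B E by (simp add: card_Diff_subset)
    then have "(\<Prod>b\<in>B. (\<nu> b)\<^sup>2) * t ^ (2 * (j - s)) = (\<Prod>b\<in>B. (\<nu> b)\<^sup>2) * (t\<^sup>2) ^ card (B - E)"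
      by (simp add: power_mult)
    also have "\<dots> \<le> Q j (Y t)"
      unfolding Q using B
      by (intro member_le_sum[of B _ "\<lambda>B. (\<Prod>b\<in>B. (\<nu> b)\<^sup>2) * (t\<^sup>2) ^ card (B - E)"]) (auto intro!: mult_nonneg_nonneg prod_nonneg)
    finally show ?thesis .
  qed
qed

text \<open>Fill \<open>k - s\<close> of the zero columns of \<open>X0 ** R\<close> with \<open>t\<close> times orthonormal vectors orthogonal to all columns. This is where
\<open>k\<close> must not exceed the number of rows: the columns span a space of dimension \<open>s\<close>, so its complement has
room for \<open>k - s\<close> vectors.\<close>

lemma exists_degenerating_line:
  fixes X0 :: "('m::{finite,linorder}, 'n::{finite,linorder}) rmat"
  assumes s: "rank X0 = s" "s < k" and k: "k \<le> CARD('m)" "k \<le> CARD('n)"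
  obtains Z a C where "0 < a" "\<And>t. \<bar>t\<bar> \<le> 1 \<Longrightarrow> a * t ^ (2 * (k - s)) \<le> Q k (X0 + t *\<^sub>R Z)"
    "\<And>j t. \<bar>t\<bar> \<le> 1 \<Longrightarrow> Q j (X0 + t *\<^sub>R Z) \<le> C j * t ^ (2 * (j - s))"
proof -
  obtain R e where fr: "singular_frame X0 R e" by (rule exists_singular_frame)
  let ?y = "\<lambda>b. column b (X0 ** R)" and ?n = "CARD('n)"
  have R: "orthogonal_matrix R" and e: "bij_betw e {..<?n} UNIV"
    and ort: "a \<noteq> b \<Longrightarrow> ?y a \<bullet> ?y b = 0" for a b
    using fr by (auto simp: singular_frame_def)
  have inj: "inj_on e {..<?n}" using e by (simp add: bij_betw_def)
  have y0: "?y (e i) \<noteq> 0 \<longleftrightarrow> i < s" if "i < ?n" for i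
    using frame_column_nonzero_iff[OF fr that] s by simp
  define d where "d = inv_into {..<?n} e"
  have d: "d b < ?n" "e (d b) = b" for b
    using e bij_betw_inv_into_right[OF e, of b] bij_betw_apply[OF bij_betw_inv_into[OF e], of b] by (auto simp: d_def)
  have de: "d (e i) = i" if "i < ?n" for i using that inj by (simp add: d_def inv_into_f_f)
  have d_eq: "d a = d b \<Longrightarrow> a = b" for a b using d(2) by metis
  have "dim (range ?y) = s"
    using rank_orthogonal_right[OF R, of X0] s by (simp add: column_rank_def columns_eq_range)
  then obtain u where u: "\<And>i. i < k - s \<Longrightarrow> norm (u i) = 1"
    "\<And>i j. i < k - s \<Longrightarrow> j < k - s \<Longrightarrow> i \<noteq> j \<Longrightarrow> u i \<bullet> u j = 0"
    "\<And>i x. i < k - s \<Longrightarrow> x \<in> range ?y \<Longrightarrow> x \<bullet> u i = (0::real)"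
    using exists_orthonormal_complement[of "k - s" "range ?y"] k s by auto
  define w where "w b = (if s \<le> d b \<and> d b < k then u (d b - s) else 0)" for b
  define W where "W = (\<chi> i b. w b $ i)"
  have colW: "column b W = w b" for b by (simp add: W_def column_def)
  define Z where "Z = W ** Finite_Cartesian_Product.transpose R"
  have "Z ** R = W" using R by (simp add: Z_def orthogonal_matrix_def flip: matrix_mul_assoc)
  define Y where "Y t = (X0 + t *\<^sub>R Z) ** R" for t
  have "Y t = X0 ** R + t *\<^sub>R W" for t
    unfolding \<open>Z ** R = W\<close>[symmetric] Y_def
    by (simp add: Finite_Cartesian_Product.vec_eq_iff matrix_matrix_mult_def algebra_simps sum.distrib sum_distrib_left)
  then have colY: "column b (Y t) = ?y b + t *\<^sub>R w b" for b t
    by (simp add: Finite_Cartesian_Product.vec_eq_iff column_def colW[symmetric])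
  define E where "E = e ` {..<s}"
  have E: "b \<in> E \<longleftrightarrow> d b < s" for b
  proof
    assume "b \<in> E"
    then obtain i where "i < s" "b = e i" by (auto simp: E_def)
    then show "d b < s" using de[of i] s k by simp
  next
    assume "d b < s"
    then have "e (d b) \<in> E" by (simp add: E_def)
    then show "b \<in> E" by (simp add: d)
  qed
  have yE: "?y b = 0" if "b \<notin> E" for b using y0[OF d(1), of b] d(2)[of b] that by (auto simp: E)
  have wE: "w b = 0" if "b \<in> E" for b using that by (simp add: w_def E)
  define \<nu> where "\<nu> b = norm (?y b + w b)" for b
  have norm: "norm (column b (Y t)) = (if b \<in> E then 1 else \<bar>t\<bar>) * \<nu> b" for t b
    by (simp add: colY \<nu>_def yE wE)
  have yw: "?y a \<bullet> w b = 0" for a b using u(3) by (auto simp: w_def)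
  have ww: "w a \<bullet> w b = 0" if "a \<noteq> b" for a b
  proof (cases "s \<le> d a \<and> d a < k \<and> s \<le> d b \<and> d b < k")
    case True
    have "d a \<noteq> d b" using d_eq[of a b] that by blast
    then have "d a - s < k - s" "d b - s < k - s" "d a - s \<noteq> d b - s" using True by linarith+
    from u(2)[OF this] show ?thesis using True by (simp add: w_def)
  qed (auto simp: w_def)
  have ortY: "column a (Y t) \<bullet> column b (Y t) = 0" if "a \<noteq> b" for t a b
    using that yw[of a b] yw[of b a] by (simp add: colY inner_simps ort ww inner_commute)
  have cardE: "card E = s"
    unfolding E_def using inj s k by (subst card_image) (auto intro: inj_on_subset)
  have QY: "Q j (X0 + t *\<^sub>R Z) = Q j (Y t)" for j t
    unfolding Y_def by (rule Q_orthogonal_right[OF R, symmetric])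
  define B where "B = e ` {..<k}"
  have B: "card B = k" "E \<subseteq> B"
    unfolding B_def E_def using inj s k by (subst card_image, auto intro: inj_on_subset)
  have "\<nu> b \<noteq> 0" if "b \<in> B" for b
  proof (cases "b \<in> E")
    case True
    then show ?thesis using y0[OF d(1), of b] d(2)[of b] by (simp add: \<nu>_def wE E)
  next
    case False
    have "d b < k" using that k de by (auto simp: B_def)
    then show ?thesis using False u(1)[of "d b - s"] by (simp add: \<nu>_def yE w_def E)
  qed
  then have "0 < (\<Prod>b\<in>B. (\<nu> b)\<^sup>2)" by (intro prod_pos) auto
  then show ?thesis
  proof (rule that)
    show "(\<Prod>b\<in>B. (\<nu> b)\<^sup>2) * t ^ (2 * (k - s)) \<le> Q k (X0 + t *\<^sub>R Z)" if "\<bar>t\<bar> \<le> 1" for t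
      unfolding QY by (rule Q_column_scaling_bounds(2)[OF ortY norm that cardE B])
    show "Q j (X0 + t *\<^sub>R Z) \<le> (\<Sum>B | card B = j. \<Prod>b\<in>B. (\<nu> b)\<^sup>2) * t ^ (2 * (j - s))" if "\<bar>t\<bar> \<le> 1" for j t
      unfolding QY by (rule Q_column_scaling_bounds(1)[OF ortY norm that cardE])
  qed
qed

text \<open>On the line of \<open>exists_degenerating_line\<close> an admissible \<open>\<theta>\<close> makes \<open>t powr (2 * p * \<theta>)\<close> at most a constant times
\<open>t ^ (2 * p - 1)\<close> as \<open>t\<close> tends to 0 from the right, where \<open>p = k - s\<close>.\<close>

lemma lojasiewicz_exponent_lower_bound:
  fixes X0 :: "('m::{finite,linorder}, 'n::{finite,linorder}) rmat"
  assumes s: "rank X0 = s" "s < k" and k: "k \<le> CARD('m)" "k \<le> CARD('n)"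
    and \<theta>: "\<theta> \<in> lojasiewicz_exponents (Q k) X0"
  shows "1 - 1 / (2 * (real k - real s)) \<le> \<theta>"
proof (rule ccontr)
  define p where "p = k - s"
  have p: "1 \<le> p" "real k - real s = real p" "k - 1 - s = p - 1" using s by (auto simp: p_def of_nat_diff)
  assume "\<not> 1 - 1 / (2 * (real k - real s)) \<le> \<theta>"
  then have "\<theta> * (2 * real p) < (1 - 1 / (2 * real p)) * (2 * real p)"
    unfolding p(2) using p(1) by (intro mult_strict_right_mono) auto
  also have "\<dots> = 2 * real p - 1" using p(1) by (simp add: field_simps)
  finally have lt: "2 * real p * \<theta> < 2 * real p - 1" by (simp add: mult_ac)
  define \<delta> where "\<delta> = 2 * real p - 1 - 2 * real p * \<theta>"
  have \<delta>: "0 < \<delta>" using lt by (simp add: \<delta>_def)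
  have Q0: "Q k X0 = 0"
    using Q_pos_iff[OF k(2), of X0] Q_nonneg[of k X0] s by auto
  obtain c where c: "0 < c" and ev: "\<forall>\<^sub>F X in nhds X0. c * Q k X powr \<theta> \<le> norm (grad (Q k) X)"
    using \<theta> by (auto simp: lojasiewicz_exponents_def Q0 Q_nonneg)
  have \<theta>0: "0 \<le> \<theta>" using \<theta> by (auto simp: lojasiewicz_exponents_def)
  obtain Z a C where a: "0 < a" "\<And>t. \<bar>t\<bar> \<le> 1 \<Longrightarrow> a * t ^ (2 * (k - s)) \<le> Q k (X0 + t *\<^sub>R Z)"
    and C: "\<And>j t. \<bar>t\<bar> \<le> 1 \<Longrightarrow> Q j (X0 + t *\<^sub>R Z) \<le> C j * t ^ (2 * (j - s))"
    using exists_degenerating_line[OF s k] by metis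
  obtain D where D: "0 < D" "\<And>X :: ('m, 'n) rmat. (norm (grad (Q k) X))\<^sup>2 \<le> D * (Q (k - 1) X * Q k X)"
    using norm_grad_Q_le by blast
  have C0: "0 \<le> C j" for j using C[of 1 j] Q_nonneg[of j "X0 + 1 *\<^sub>R Z"] by simp
  define M where "M = sqrt (D * (C (k - 1) * C k))"
  have grad_le: "norm (grad (Q k) (X0 + t *\<^sub>R Z)) \<le> M * t ^ (2 * p - 1)" if t: "0 < t" "t \<le> 1" for t
  proof -
    have "(norm (grad (Q k) (X0 + t *\<^sub>R Z)))\<^sup>2 \<le> D * (Q (k - 1) (X0 + t *\<^sub>R Z) * Q k (X0 + t *\<^sub>R Z))"
      by (rule D(2))
    also have "\<dots> \<le> D * ((C (k - 1) * t ^ (2 * (p - 1))) * (C k * t ^ (2 * p)))"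
    proof (intro mult_left_mono mult_mono)
      show "Q (k - 1) (X0 + t *\<^sub>R Z) \<le> C (k - 1) * t ^ (2 * (p - 1))"
        using C[of t "k - 1"] t unfolding p(3) by simp
      show "Q k (X0 + t *\<^sub>R Z) \<le> C k * t ^ (2 * p)"
        using C[of t k] t by (simp add: p_def)
    qed (use D(1) C0 t in \<open>auto simp: Q_nonneg\<close>)
    also have "\<dots> = (D * (C (k - 1) * C k)) * (t ^ (2 * (p - 1)) * t ^ (2 * p))" by (simp only: mult_ac)
    also have "t ^ (2 * (p - 1)) * t ^ (2 * p) = (t ^ (2 * p - 1))\<^sup>2"
      using p(1) by (simp flip: power_add power_mult add: algebra_simps)
    also have "D * (C (k - 1) * C k) = M\<^sup>2" using D(1) C0 by (simp add: M_def)
    finally have "(norm (grad (Q k) (X0 + t *\<^sub>R Z)))\<^sup>2 \<le> (M * t ^ (2 * p - 1))\<^sup>2" by (simp add: power_mult_distrib)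
    then show ?thesis
      by (rule power2_le_imp_le) (use t D(1) C0 in \<open>auto simp: M_def\<close>)
  qed
  have "((\<lambda>t. X0 + t *\<^sub>R Z) \<longlongrightarrow> X0 + 0 *\<^sub>R Z) (at_right 0)"
    by (intro tendsto_intros)
  then have "filterlim (\<lambda>t. X0 + t *\<^sub>R Z) (nhds X0) (at_right 0)" by simp
  then have "\<forall>\<^sub>F t in at_right 0. c * Q k (X0 + t *\<^sub>R Z) powr \<theta> \<le> norm (grad (Q k) (X0 + t *\<^sub>R Z))"
    using ev by (rule eventually_compose_filterlim[rotated])
  moreover have "\<forall>\<^sub>F t in at_right 0. t < (1::real)" "\<forall>\<^sub>F t in at_right 0. (0::real) < t"
    by (auto simp: eventually_at_right_field intro: exI[of _ 1])
  moreover have "((\<lambda>t. M * t powr \<delta>) \<longlongrightarrow> M * 0) (at_right 0)"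
    using \<delta> by (intro tendsto_mult_left tendsto_zero_powrI tendsto_const) (auto simp: eventually_at_right_field intro: exI[of _ 1])
  then have "\<forall>\<^sub>F t in at_right 0. M * t powr \<delta> < c * a powr \<theta>"
    using c a(1) by (intro order_tendstoD) auto
  ultimately have "\<forall>\<^sub>F t in at_right (0::real). False"
  proof eventually_elim
    case (elim t)
    have "c * (a powr \<theta> * t powr (2 * real p * \<theta>)) = c * (a * t ^ (2 * p)) powr \<theta>"
      using elim a(1) by (simp add: powr_mult powr_powr flip: powr_realpow)
    also have "\<dots> \<le> c * Q k (X0 + t *\<^sub>R Z) powr \<theta>"
      using a(2)[of t] a(1) elim c \<theta>0 by (intro mult_left_mono powr_mono2) (auto simp: p_def)
    also have "\<dots> \<le> M * t ^ (2 * p - 1)" using elim grad_le[of t] by auto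
    also have "t ^ (2 * p - 1) = t powr \<delta> * t powr (2 * real p * \<theta>)"
      using elim p(1) by (simp add: \<delta>_def of_nat_diff flip: powr_realpow powr_add)
    finally have "(c * a powr \<theta>) * t powr (2 * real p * \<theta>) \<le> (M * t powr \<delta>) * t powr (2 * real p * \<theta>)"
      by (simp add: mult_ac)
    then have "c * a powr \<theta> \<le> M * t powr \<delta>" using elim by (simp add: mult_le_cancel_right)
    then show False using elim by simp
  qed
  then show False by simp
qed

lemma optimal_lojasiewicz_exponent_Q:
  fixes X0 :: "('m::{finite,linorder}, 'n::{finite,linorder}) rmat"
  assumes "rank X0 = s" "s < k" "k \<le> CARD('m)" "k \<le> CARD('n)"
  shows "optimal_lojasiewicz_exponent (Q k) X0 = ereal (1 - 1 / (2 * (real k - real s)))"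
  unfolding optimal_lojasiewicz_exponent_def
proof (rule antisym)
  show "(INF \<theta>\<in>lojasiewicz_exponents (Q k) X0. ereal \<theta>) \<le> ereal (1 - 1 / (2 * (real k - real s)))"
    using lojasiewicz_exponent_attained[OF assms(1,2,4)] by (rule INF_lower)
  show "ereal (1 - 1 / (2 * (real k - real s))) \<le> (INF \<theta>\<in>lojasiewicz_exponents (Q k) X0. ereal \<theta>)"
    by (intro INF_greatest) (use lojasiewicz_exponent_lower_bound[OF assms] in simp)
qed

section \<open>Orders along analytic arcs and integral closures\<close>

lemma has_fps_expansion_div_power_tendsto:
  fixes f :: "real \<Rightarrow> real"
  assumes f: "f has_fps_expansion F" and n: "n \<le> subdegree F"
  shows "((\<lambda>t. f t / t ^ n) \<longlongrightarrow> fps_nth F n) (at 0)"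
proof -
  define S where "S = fps_shift n F"
  have FS: "F = S * fps_X ^ n"
    using n by (simp add: S_def fps_shift_times_fps_X_power)
  have "fps_conv_radius S > 0"
    using f by (simp add: S_def has_fps_expansion_def)
  then have S: "eval_fps S has_fps_expansion S" by (rule eval_fps_has_fps_expansion)
  have "(\<lambda>z. eval_fps S z * z ^ n) has_fps_expansion S * fps_X ^ n"
    by (intro fps_expansion_intros S)
  then have "\<forall>\<^sub>F z in nhds 0. eval_fps F z = eval_fps S z * z ^ n"
    by (simp add: has_fps_expansion_def FS)
  moreover have "\<forall>\<^sub>F z in nhds 0. eval_fps F z = f z"
    using f by (simp add: has_fps_expansion_def)
  ultimately have "\<forall>\<^sub>F z in nhds 0. f z = eval_fps S z * z ^ n"
    by eventually_elim simp
  then have "\<forall>\<^sub>F z in at 0. eval_fps S z = f z / z ^ n"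
    unfolding eventually_at_filter by eventually_elim auto
  moreover have "(eval_fps S \<longlongrightarrow> eval_fps S 0) (at 0)"
    using has_fps_expansion_imp_continuous[OF S, of UNIV] by (simp add: continuous_within)
  ultimately have "((\<lambda>t. f t / t ^ n) \<longlongrightarrow> eval_fps S 0) (at 0)"
    by (rule Lim_transform_eventually[rotated])
  then show ?thesis by (simp add: eval_fps_at_0 S_def)
qed

text \<open>If \<open>f\<close> vanished to a smaller order \<open>n\<close> than \<open>g\<close>, then in the limit \<open>t \<rightarrow> 0\<close> of the inequality divided by \<open>\<bar>t ^ n\<bar>\<close> the left-hand side
would be nonzero and the right-hand side 0.\<close>

lemma vanishing_order_mono:
  assumes f: "f has_fps_expansion F" and g: "g has_fps_expansion G"
    and le: "\<And>t. \<bar>f t\<bar> \<le> C * \<bar>g t\<bar>"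
  shows "vanishing_order g \<le> vanishing_order f"
proof (cases "F = 0")
  case False
  have "G \<noteq> 0"
  proof
    assume "G = 0"
    then have "\<forall>\<^sub>F t in nhds 0. g t = 0" using g by (auto simp: has_fps_expansion_def elim: eventually_mono)
    then have "\<forall>\<^sub>F t in nhds 0. f t = 0"
    proof eventually_elim
      case (elim t)
      then show ?case using le[of t] by simp
    qed
    then have "f has_fps_expansion 0" by (auto simp: has_fps_expansion_def elim: eventually_mono)
    then show False using real_fps_expansion_unique[OF f] False by blast
  qed
  have "subdegree G \<le> subdegree F"
  proof (rule ccontr)
    let ?a = "subdegree F"
    assume "\<not> subdegree G \<le> ?a"
    then have "?a < subdegree G" by simp
    then have "fps_nth G ?a = 0"
      by (rule nth_less_subdegree_zero)
    with \<open>?a < subdegree G\<close> have "((\<lambda>t. g t / t ^ ?a) \<longlongrightarrow> 0) (at 0)"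
      using has_fps_expansion_div_power_tendsto[OF g, of ?a] by simp
    then have "((\<lambda>t. C * \<bar>g t / t ^ ?a\<bar>) \<longlongrightarrow> C * \<bar>0\<bar>) (at 0)"
      by (intro tendsto_intros)
    moreover have "((\<lambda>t. \<bar>f t / t ^ ?a\<bar>) \<longlongrightarrow> \<bar>fps_nth F ?a\<bar>) (at 0)"
      by (intro tendsto_rabs has_fps_expansion_div_power_tendsto[OF f]) simp
    moreover have "\<forall>\<^sub>F t in at 0. \<bar>f t / t ^ ?a\<bar> \<le> C * \<bar>g t / t ^ ?a\<bar>"
    proof (intro always_eventually allI)
      fix t :: real
      show "\<bar>f t / t ^ ?a\<bar> \<le> C * \<bar>g t / t ^ ?a\<bar>"
        using divide_right_mono[OF le[of t], of "\<bar>t ^ ?a\<bar>"] by simp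
    qed
    ultimately have "\<bar>fps_nth F ?a\<bar> \<le> C * \<bar>0\<bar>"
      by (intro tendsto_le[of "at (0::real)"]) auto
    then show False using False nth_subdegree_nonzero by simp
  qed
  then show ?thesis
    using False \<open>G \<noteq> 0\<close> by (simp add: vanishing_order_eq[OF f] vanishing_order_eq[OF g])
qed (simp add: vanishing_order_eq[OF f])

lemma INF_enat_attained:
  fixes f :: "'a \<Rightarrow> enat"
  assumes "A \<noteq> {}"
  obtains a where "a \<in> A" "f a = (INF x\<in>A. f x)"
proof -
  have "(INF x\<in>A. f x) \<in> f ` A"
    using assms wellorder_InfI[of _ "f ` A"] by blast
  then show ?thesis using that by auto
qed

text \<open>Over the reals the leading coefficients of squares are positive and cannot cancel: every single square is bounded by
the sum.\<close>

lemma vanishing_order_sum_squares: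
  assumes fin: "finite I" and f: "\<And>i. i \<in> I \<Longrightarrow> \<exists>F. f i has_fps_expansion F"
  shows "vanishing_order (\<lambda>t. \<Sum>i\<in>I. (f i t)\<^sup>2) = (INF i\<in>I. vanishing_order (f i)) + (INF i\<in>I. vanishing_order (f i))"
proof (cases "I = {}")
  case True
  have "vanishing_order (\<lambda>t. 0) = \<infinity>"
    using vanishing_order_eq[of "\<lambda>t. 0" 0] by simp
  then show ?thesis using True by (simp add: top_enat_def)
next
  case False
  define \<mu> where "\<mu> = (INF i\<in>I. vanishing_order (f i))"
  have sq: "\<exists>F. (\<lambda>t. (f i t)\<^sup>2) has_fps_expansion F"
      "vanishing_order (\<lambda>t. (f i t)\<^sup>2) = vanishing_order (f i) + vanishing_order (f i)" if "i \<in> I" for i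
    using f[OF that] vanishing_order_mult has_fps_expansion_mult unfolding power2_eq_square by blast+
  have sum: "(\<exists>F. (\<lambda>t. \<Sum>i\<in>J. (f i t)\<^sup>2) has_fps_expansion F) \<and> \<mu> + \<mu> \<le> vanishing_order (\<lambda>t. \<Sum>i\<in>J. (f i t)\<^sup>2)"
    if "finite J" "J \<subseteq> I" for J
    using that
  proof (induction J rule: finite_induct)
    case empty
    have "(\<lambda>t::real. 0::real) has_fps_expansion 0" by simp
    then show ?case using vanishing_order_eq[of "\<lambda>t. 0" 0] by auto
  next
    case (insert j J)
    then have j: "j \<in> I" and IH: "\<exists>F. (\<lambda>t. \<Sum>i\<in>J. (f i t)\<^sup>2) has_fps_expansion F"
        "\<mu> + \<mu> \<le> vanishing_order (\<lambda>t. \<Sum>i\<in>J. (f i t)\<^sup>2)" by auto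
    obtain F H where FH: "(\<lambda>t. (f j t)\<^sup>2) has_fps_expansion F" "(\<lambda>t. \<Sum>i\<in>J. (f i t)\<^sup>2) has_fps_expansion H"
      using sq(1)[OF j] IH(1) by blast
    have "\<mu> \<le> vanishing_order (f j)" unfolding \<mu>_def by (rule INF_lower[OF j])
    then have "\<mu> + \<mu> \<le> vanishing_order (\<lambda>t. (f j t)\<^sup>2)"
      unfolding sq(2)[OF j] by (intro add_mono)
    then have "\<mu> + \<mu> \<le> vanishing_order (\<lambda>t. (f j t)\<^sup>2 + (\<Sum>i\<in>J. (f i t)\<^sup>2))"
      using IH(2) vanishing_order_add[OF FH] by (meson min.boundedI order_trans)
    then show ?case
      using has_fps_expansion_add[OF FH] insert.hyps by auto
  qed
  obtain i where i: "i \<in> I" "vanishing_order (f i) = \<mu>"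
    using INF_enat_attained[OF False] unfolding \<mu>_def by metis
  obtain F H where FH: "(\<lambda>t. (f i t)\<^sup>2) has_fps_expansion F" "(\<lambda>t. \<Sum>i\<in>I. (f i t)\<^sup>2) has_fps_expansion H"
    using sq(1)[OF i(1)] sum[OF fin order_refl] by blast
  have "vanishing_order (\<lambda>t. \<Sum>i\<in>I. (f i t)\<^sup>2) \<le> vanishing_order (\<lambda>t. (f i t)\<^sup>2)"
  proof (rule vanishing_order_mono[OF FH, of 1])
    fix t
    have "(f i t)\<^sup>2 \<le> (\<Sum>i\<in>I. (f i t)\<^sup>2)"
      using fin i(1) by (intro member_le_sum) auto
    then show "\<bar>(f i t)\<^sup>2\<bar> \<le> 1 * \<bar>\<Sum>i\<in>I. (f i t)\<^sup>2\<bar>" by simp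
  qed
  then show ?thesis
    using sum[OF fin order_refl] sq(2)[OF i(1)] i(2) unfolding \<mu>_def[symmetric] by (intro antisym) auto
qed

lemma arc_order_germs:
  assumes \<gamma>: "analytic_arc X0 \<gamma>" and f: "\<And>i. i \<in> I \<Longrightarrow> real_analytic_at (f i) X0"
  shows "arc_order \<gamma> (Idl\<^bsub>germ_ring X0\<^esub> ((\<lambda>i. germ X0 (f i)) ` I)) = (INF i\<in>I. vanishing_order (f i \<circ> \<gamma>))"
proof -
  have 1: "(\<lambda>i. germ X0 (f i)) ` I \<subseteq> carrier (germ_ring X0)"
    using f by (auto simp: carrier_germ_ring)
  have 2: "(INF h\<in>germ X0 (f i). vanishing_order (h \<circ> \<gamma>)) = vanishing_order (f i \<circ> \<gamma>)" if "i \<in> I" for i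
  proof -
    have "f i \<in> germ X0 (f i)" using f[OF that] by (simp add: mem_germ_iff)
    have "(INF h\<in>germ X0 (f i). vanishing_order (h \<circ> \<gamma>)) = (INF h\<in>germ X0 (f i). vanishing_order (f i \<circ> \<gamma>))"
      by (intro INF_cong refl vanishing_order_germ_cong[OF \<gamma> f[OF that]])
    also have "\<dots> = vanishing_order (f i \<circ> \<gamma>)" using \<open>f i \<in> germ X0 (f i)\<close> by (intro INF_const) auto
    finally show ?thesis .
  qed
  have "arc_order \<gamma> (Idl\<^bsub>germ_ring X0\<^esub> ((\<lambda>i. germ X0 (f i)) ` I)) = arc_order \<gamma> ((\<lambda>i. germ X0 (f i)) ` I)"
    by (rule arc_order_genideal[OF \<gamma> 1])
  also have "\<dots> = (INF i\<in>I. INF h\<in>germ X0 (f i). vanishing_order (h \<circ> \<gamma>))"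
    by (simp add: arc_order_def image_image)
  also have "\<dots> = (INF i\<in>I. vanishing_order (f i \<circ> \<gamma>))"
    by (intro INF_cong refl 2)
  finally show ?thesis .
qed

lemma arc_order_ideal_prod:
  assumes \<gamma>: "analytic_arc X0 \<gamma>" and I: "ideal I (germ_ring X0)" and J: "ideal J (germ_ring X0)"
  shows "arc_order \<gamma> (I \<cdot>\<^bsub>germ_ring X0\<^esub> J) = arc_order \<gamma> I + arc_order \<gamma> J"
proof -
  interpret R: cring "germ_ring X0" by (rule cring_germ_ring)
  interpret I: ideal I "germ_ring X0" by (rule I)
  interpret J: ideal J "germ_ring X0" by (rule J)
  let ?P = "I <#>\<^bsub>germ_ring X0\<^esub> J"
  have rep: "\<exists>f. real_analytic_at f X0 \<and> a = germ X0 f \<and> f \<in> a \<and> (\<forall>g\<in>a. vanishing_order (g \<circ> \<gamma>) = vanishing_order (f \<circ> \<gamma>))"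
    if "a \<in> carrier (germ_ring X0)" for a
  proof -
    obtain f where f: "real_analytic_at f X0" "a = germ X0 f" using \<open>a \<in> _\<close> by (auto simp: carrier_germ_ring)
    then have "f \<in> a" by (simp add: mem_germ_iff)
    then show ?thesis using f vanishing_order_germ_cong[OF \<gamma> f(1)] by blast
  qed
  have prod: "vanishing_order (h \<circ> \<gamma>) = vanishing_order (f \<circ> \<gamma>) + vanishing_order (g \<circ> \<gamma>)"
    if f: "real_analytic_at f X0" and g: "real_analytic_at g X0"
      and h: "h \<in> germ X0 f \<otimes>\<^bsub>germ_ring X0\<^esub> germ X0 g" for f g h
  proof -
    have "vanishing_order (h \<circ> \<gamma>) = vanishing_order ((\<lambda>X. f X * g X) \<circ> \<gamma>)"
      using h unfolding germ_mult[OF f g] by (intro vanishing_order_germ_cong[OF \<gamma>] real_analytic_at_mult f g)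
    also have "\<dots> = vanishing_order (\<lambda>t. (f \<circ> \<gamma>) t * (g \<circ> \<gamma>) t)" by (simp add: o_def)
    also have "\<dots> = vanishing_order (f \<circ> \<gamma>) + vanishing_order (g \<circ> \<gamma>)"
      using analytic_arc_comp[OF f \<gamma>] analytic_arc_comp[OF g \<gamma>] vanishing_order_mult by blast
    finally show ?thesis .
  qed
  have attained: "\<exists>f. real_analytic_at f X0 \<and> germ X0 f \<in> K \<and> vanishing_order (f \<circ> \<gamma>) = arc_order \<gamma> K"
    if K: "ideal K (germ_ring X0)" for K
  proof -
    interpret K: ideal K "germ_ring X0" by (rule K)
    have "K \<noteq> {}" using K.zero_closed by blast
    then obtain a where a: "a \<in> K" "(INF f\<in>a. vanishing_order (f \<circ> \<gamma>)) = arc_order \<gamma> K"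
      unfolding arc_order_def by (rule INF_enat_attained)
    obtain f where f: "real_analytic_at f X0" "a = germ X0 f" "f \<in> a" "\<forall>g\<in>a. vanishing_order (g \<circ> \<gamma>) = vanishing_order (f \<circ> \<gamma>)"
      using rep[OF K.Icarr[OF a(1)]] by blast
    have "(INF g\<in>a. vanishing_order (g \<circ> \<gamma>)) = (INF g\<in>a. vanishing_order (f \<circ> \<gamma>))"
      using f(4) by (intro INF_cong refl) blast
    also have "\<dots> = vanishing_order (f \<circ> \<gamma>)" using f(3) by (intro INF_const) auto
    finally have "vanishing_order (f \<circ> \<gamma>) = arc_order \<gamma> K" using a(2) by simp
    then show ?thesis using f(1,2) a(1) by blast
  qed
  have "arc_order \<gamma> (I \<cdot>\<^bsub>germ_ring X0\<^esub> J) = arc_order \<gamma> (Idl\<^bsub>germ_ring X0\<^esub> ?P)"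
    by (simp add: R.ideal_prod_eq_genideal[OF I J])
  also have "\<dots> = arc_order \<gamma> ?P"
    by (rule arc_order_genideal[OF \<gamma>]) (auto simp: set_mult_def dest!: I.Icarr J.Icarr)
  also have "\<dots> = arc_order \<gamma> I + arc_order \<gamma> J"
  proof (rule antisym)
    obtain f g where f: "real_analytic_at f X0" "germ X0 f \<in> I" "vanishing_order (f \<circ> \<gamma>) = arc_order \<gamma> I"
      and g: "real_analytic_at g X0" "germ X0 g \<in> J" "vanishing_order (g \<circ> \<gamma>) = arc_order \<gamma> J"
      using attained[OF I] attained[OF J] by blast
    have "germ X0 f \<otimes>\<^bsub>germ_ring X0\<^esub> germ X0 g \<in> ?P" using f g by (auto simp: set_mult_def)
    moreover have "(\<lambda>X. f X * g X) \<in> germ X0 f \<otimes>\<^bsub>germ_ring X0\<^esub> germ X0 g"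
      by (simp add: germ_mult f g mem_germ_iff real_analytic_at_mult)
    ultimately have "arc_order \<gamma> ?P \<le> vanishing_order ((\<lambda>X. f X * g X) \<circ> \<gamma>)"
      using ge_arc_order_iff by blast
    also have "\<dots> = arc_order \<gamma> I + arc_order \<gamma> J"
      using prod[OF f(1) g(1) \<open>(\<lambda>X. f X * g X) \<in> _\<close>] f(3) g(3) by simp
    finally show "arc_order \<gamma> ?P \<le> arc_order \<gamma> I + arc_order \<gamma> J" .
    show "arc_order \<gamma> I + arc_order \<gamma> J \<le> arc_order \<gamma> ?P"
      unfolding ge_arc_order_iff
    proof (intro ballI)
      fix c h assume "c \<in> ?P" "h \<in> c"
      then obtain a b where ab: "a \<in> I" "b \<in> J" "c = a \<otimes>\<^bsub>germ_ring X0\<^esub> b" by (auto simp: set_mult_def)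
      obtain f where f: "real_analytic_at f X0" "a = germ X0 f" "f \<in> a" using rep[OF I.Icarr[OF ab(1)]] by blast
      obtain g where g: "real_analytic_at g X0" "b = germ X0 g" "g \<in> b" using rep[OF J.Icarr[OF ab(2)]] by blast
      have "arc_order \<gamma> I \<le> vanishing_order (f \<circ> \<gamma>)" "arc_order \<gamma> J \<le> vanishing_order (g \<circ> \<gamma>)"
        using ab f(3) g(3) ge_arc_order_iff by blast+
      moreover have "vanishing_order (h \<circ> \<gamma>) = vanishing_order (f \<circ> \<gamma>) + vanishing_order (g \<circ> \<gamma>)"
        using prod[OF f(1) g(1)] \<open>h \<in> c\<close> ab(3) f(2) g(2) by simp
      ultimately show "arc_order \<gamma> I + arc_order \<gamma> J \<le> vanishing_order (h \<circ> \<gamma>)"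
        by (simp add: add_mono)
    qed
  qed
  finally show ?thesis .
qed

lemma real_integral_closure_cong:
  assumes "\<And>\<gamma>. analytic_arc X0 \<gamma> \<Longrightarrow> arc_order \<gamma> I = arc_order \<gamma> J"
  shows "real_integral_closure X0 I = real_integral_closure X0 J"
  unfolding real_integral_closure_def using assms by auto

lemma ideal_minors_ideal: "ideal (minors_ideal X0 k) (germ_ring X0)"
proof -
  interpret R: cring "germ_ring X0" by (rule cring_germ_ring)
  show ?thesis unfolding minors_ideal_def
    by (intro R.genideal_ideal) (auto simp: carrier_germ_ring intro!: imageI real_analytic_at_minor)
qed

lemma vanishing_order_Q:
  fixes X0 :: "('m::{finite,linorder}, 'n::{finite,linorder}) rmat"
  assumes \<gamma>: "analytic_arc X0 \<gamma>"
  shows "vanishing_order (Q k \<circ> \<gamma>) = arc_order \<gamma> (minors_ideal X0 k) + arc_order \<gamma> (minors_ideal X0 k)"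
proof -
  let ?I = "{A :: 'm set. card A = k} \<times> {B :: 'n set. card B = k}"
  let ?f = "\<lambda>(A, B). minor A B :: ('m, 'n) rmat \<Rightarrow> real"
  have an: "real_analytic_at (?f i) X0" if "i \<in> ?I" for i
    using that by (auto intro: real_analytic_at_minor)
  have "{germ X0 (minor A B) |A B. card A = k \<and> card B = k} = (\<lambda>i. germ X0 (?f i)) ` ?I"
    by (auto intro: rev_image_eqI[of "(_, _)"])
  then have "arc_order \<gamma> (minors_ideal X0 k) = (INF i\<in>?I. vanishing_order (?f i \<circ> \<gamma>))"
    unfolding minors_ideal_def using arc_order_germs[OF \<gamma> an] by simp
  moreover have "Q k \<circ> \<gamma> = (\<lambda>t. \<Sum>i\<in>?I. ((?f i \<circ> \<gamma>) t)\<^sup>2)"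
    by (auto simp: Q_def sum.cartesian_product intro!: sum.cong)
  moreover have "vanishing_order (\<lambda>t. \<Sum>i\<in>?I. ((?f i \<circ> \<gamma>) t)\<^sup>2) =
      (INF i\<in>?I. vanishing_order (?f i \<circ> \<gamma>)) + (INF i\<in>?I. vanishing_order (?f i \<circ> \<gamma>))"
    by (intro vanishing_order_sum_squares analytic_arc_comp[OF an \<gamma>]) auto
  ultimately show ?thesis by simp
qed

lemma vanishing_order_norm_grad:
  fixes X0 :: "('m::{finite,linorder}, 'n::{finite,linorder}) rmat"
  assumes \<gamma>: "analytic_arc X0 \<gamma>"
  shows "\<exists>F. (\<lambda>t. (norm (grad (Q k) (\<gamma> t)))\<^sup>2) has_fps_expansion F"
    and "vanishing_order (\<lambda>t. (norm (grad (Q k) (\<gamma> t)))\<^sup>2) =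
         arc_order \<gamma> (jacobian_ideal X0 (Q k)) + arc_order \<gamma> (jacobian_ideal X0 (Q k))"
proof -
  let ?f = "\<lambda>(i, j). partial_deriv i j (Q k) :: ('m, 'n) rmat \<Rightarrow> real"
  have an: "real_analytic_at (?f p) X0" for p
    by (auto simp: split_beta intro: real_analytic_at_partial_deriv_Q)
  have norm: "(norm (grad (Q k) X))\<^sup>2 = (\<Sum>p\<in>UNIV. (?f p X)\<^sup>2)" for X :: "('m, 'n) rmat"
    by (simp add: norm_grad_power2 sum.cartesian_product split_beta)
  have "real_analytic_at (\<lambda>X. \<Sum>p\<in>UNIV. (?f p X)\<^sup>2) X0"
    unfolding power2_eq_square by (intro real_analytic_at_sum real_analytic_at_mult an)
  then show "\<exists>F. (\<lambda>t. (norm (grad (Q k) (\<gamma> t)))\<^sup>2) has_fps_expansion F"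
    using analytic_arc_comp[OF _ \<gamma>] by (simp add: norm o_def)
  have "{germ X0 (partial_deriv i j (Q k)) |i j. True} = (\<lambda>p. germ X0 (?f p)) ` UNIV"
    by (auto intro: rev_image_eqI[of "(_, _)"])
  then have "arc_order \<gamma> (jacobian_ideal X0 (Q k)) = (INF p. vanishing_order (?f p \<circ> \<gamma>))"
    unfolding jacobian_ideal_def using arc_order_germs[OF \<gamma>, of UNIV ?f] an by simp
  moreover have "vanishing_order (\<lambda>t. \<Sum>p\<in>UNIV. ((?f p \<circ> \<gamma>) t)\<^sup>2) =
      (INF p. vanishing_order (?f p \<circ> \<gamma>)) + (INF p. vanishing_order (?f p \<circ> \<gamma>))"
    by (intro vanishing_order_sum_squares analytic_arc_comp[OF an \<gamma>]) auto
  ultimately show "vanishing_order (\<lambda>t. (norm (grad (Q k) (\<gamma> t)))\<^sup>2) =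
         arc_order \<gamma> (jacobian_ideal X0 (Q k)) + arc_order \<gamma> (jacobian_ideal X0 (Q k))"
    by (simp add: norm)
qed

text \<open>Twice the order of the Jacobian ideal is the order of \<open>\<parallel>grad (Q k)\<parallel>\<^sup>2\<close>, which is that of the comparable function
\<open>Q (k - 1) * Q k\<close>.\<close>

lemma arc_order_jacobian_ideal:
  fixes X0 :: "('m::{finite,linorder}, 'n::{finite,linorder}) rmat"
  assumes \<gamma>: "analytic_arc X0 \<gamma>" and k: "1 \<le> k" "k \<le> CARD('n)"
  shows "arc_order \<gamma> (jacobian_ideal X0 (Q k)) = arc_order \<gamma> (minors_ideal X0 (k - 1)) + arc_order \<gamma> (minors_ideal X0 k)"
proof -
  let ?g = "\<lambda>t. (norm (grad (Q k) (\<gamma> t)))\<^sup>2" and ?q = "\<lambda>t. (Q (k - 1) \<circ> \<gamma>) t * (Q k \<circ> \<gamma>) t"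
  obtain F where F: "?g has_fps_expansion F" using vanishing_order_norm_grad(1)[OF \<gamma>] by blast
  obtain G H where GH: "(Q (k - 1) \<circ> \<gamma>) has_fps_expansion G" "(Q k \<circ> \<gamma>) has_fps_expansion H"
    using analytic_arc_comp[OF real_analytic_at_Q \<gamma>] by metis
  have q: "?q has_fps_expansion G * H" by (intro has_fps_expansion_mult GH)
  obtain C where C: "0 < C" "\<And>X :: ('m, 'n) rmat. (norm (grad (Q k) X))\<^sup>2 \<le> C * (Q (k - 1) X * Q k X)"
    using norm_grad_Q_le by blast
  have "vanishing_order ?q \<le> vanishing_order ?g"
    using C(2) by (intro vanishing_order_mono[OF F q, of C]) (simp add: Q_nonneg abs_mult)
  moreover have "vanishing_order ?g \<le> vanishing_order ?q"
    using norm_grad_Q_ge[OF k] by (intro vanishing_order_mono[OF q F, of "4 ^ CARD('n)"]) (simp add: Q_nonneg abs_mult)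
  moreover have "vanishing_order ?q = vanishing_order (Q (k - 1) \<circ> \<gamma>) + vanishing_order (Q k \<circ> \<gamma>)"
    by (rule vanishing_order_mult[OF GH])
  ultimately have eq: "arc_order \<gamma> (jacobian_ideal X0 (Q k)) + arc_order \<gamma> (jacobian_ideal X0 (Q k)) =
      (arc_order \<gamma> (minors_ideal X0 (k - 1)) + arc_order \<gamma> (minors_ideal X0 (k - 1))) +
      (arc_order \<gamma> (minors_ideal X0 k) + arc_order \<gamma> (minors_ideal X0 k))"
    unfolding vanishing_order_norm_grad(2)[OF \<gamma>] vanishing_order_Q[OF \<gamma>] by simp
  have "a = b + c" if "a + a = (b + b) + (c + c)" for a b c :: enat
    using that by (cases a; cases b; cases c) auto
  from this[OF eq] show ?thesis .
qed

theorem theorem3p9: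
  fixes X0 :: "('m::{finite,linorder}, 'n::{finite,linorder}) rmat" and k :: nat
  assumes "1 \<le> k" and "k \<le> min CARD('m) CARD('n)"
  shows
    "real_integral_closure X0 (Idl\<^bsub>germ_ring X0\<^esub> {germ X0 (Q k)}) =
       real_integral_closure X0 (minors_ideal X0 k \<cdot>\<^bsub>germ_ring X0\<^esub> minors_ideal X0 k) \<and>
     real_integral_closure X0 (jacobian_ideal X0 (Q k)) =
       real_integral_closure X0 (minors_ideal X0 (k - 1) \<cdot>\<^bsub>germ_ring X0\<^esub> minors_ideal X0 k) \<and>
     (\<forall>s. rank X0 = s \<and> s < k \<longrightarrow>
       optimal_lojasiewicz_exponent (Q k) X0 = ereal (1 - 1 / (2 * (real k - real s)))) \<and>
     optimal_lojasiewicz_exponent (Q k :: ('m, 'n) rmat \<Rightarrow> real) 0 = ereal ((2 * real k - 1) / (2 * real k)) \<and>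
     (rank X0 = k - 1 \<longrightarrow> optimal_lojasiewicz_exponent (Q k) X0 = ereal (1 / 2))"
proof (intro conjI allI impI)
  have k: "k \<le> CARD('m)" "k \<le> CARD('n)" using assms by auto
  show "real_integral_closure X0 (Idl\<^bsub>germ_ring X0\<^esub> {germ X0 (Q k)}) =
       real_integral_closure X0 (minors_ideal X0 k \<cdot>\<^bsub>germ_ring X0\<^esub> minors_ideal X0 k)"
  proof (rule real_integral_closure_cong)
    fix \<gamma> assume \<gamma>: "analytic_arc X0 \<gamma>"
    have "arc_order \<gamma> (Idl\<^bsub>germ_ring X0\<^esub> {germ X0 (Q k)}) = vanishing_order (Q k \<circ> \<gamma>)"
      using arc_order_germs[OF \<gamma>, of "{()}" "\<lambda>_. Q k"] by (simp add: real_analytic_at_Q)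
    then show "arc_order \<gamma> (Idl\<^bsub>germ_ring X0\<^esub> {germ X0 (Q k)}) =
        arc_order \<gamma> (minors_ideal X0 k \<cdot>\<^bsub>germ_ring X0\<^esub> minors_ideal X0 k)"
      by (simp add: vanishing_order_Q[OF \<gamma>] arc_order_ideal_prod[OF \<gamma>] ideal_minors_ideal)
  qed
  show "real_integral_closure X0 (jacobian_ideal X0 (Q k)) =
       real_integral_closure X0 (minors_ideal X0 (k - 1) \<cdot>\<^bsub>germ_ring X0\<^esub> minors_ideal X0 k)"
    by (rule real_integral_closure_cong)
       (use assms k in \<open>simp add: arc_order_jacobian_ideal arc_order_ideal_prod ideal_minors_ideal\<close>)
  show "optimal_lojasiewicz_exponent (Q k) X0 = ereal (1 - 1 / (2 * (real k - real s)))"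
    if "rank X0 = s \<and> s < k" for s
    using optimal_lojasiewicz_exponent_Q[of X0 s k] that k by simp
  show "optimal_lojasiewicz_exponent (Q k :: ('m, 'n) rmat \<Rightarrow> real) 0 = ereal ((2 * real k - 1) / (2 * real k))"
    using optimal_lojasiewicz_exponent_Q[of "0 :: ('m, 'n) rmat" 0 k] assms k by (simp add: field_simps)
  show "optimal_lojasiewicz_exponent (Q k) X0 = ereal (1 / 2)" if "rank X0 = k - 1"
    using optimal_lojasiewicz_exponent_Q[of X0 "k - 1" k] that assms k by (simp add: of_nat_diff)
qed

end
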